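(* Let $f\colon\mathcal{X}\to\mathcal{X}$ be an interval map with ergodic (invariant) probability measure $\mu$, and assume that $(f,\mathcal{X},\mu)$ has exponential decay of correlations for $\mathrm{BV}$ versus $L^\infty$. Let $\tilde{x}\in\mathcal{X}$ and $\phi(x)=\psi(\mathrm{dist}(x,\tilde{x}))$ with $\psi(y)\to\infty$ as $y\to0$, and suppose that the short return times condition (A2) (see context) holds for sequences of balls centered at $\tilde{x}$. Let $(r_n)$ be a non-increasing sequence of positive numbers with $r_n\to 0$ such that $n\mapsto n\mu(B(\tilde{x},r_n))$ is non-decreasing, and write $u_n=\psi(r_n)$. (1) Suppose $$\sum_{n=1}^\infty\mu(B(\tilde{x},r_n))e^{-n\mu(B(\tilde{x},r_n))}<\infty .$$ Then for any $a>1$, $\mu\bigl(M_n\ge\psi(r_{[n/a]})\text{ ev.}\bigr)=1$. In particular, if $\mu(\phi\ge u_n)\ge c\,\frac{\log\log n}{n}$ (for all large $n$) for some constant $c>1$, then $\mu(\mathcal{H}_{\mathrm{ea}})=\mu(u_n\le M_n\text{ ev.})=1$. (2) Suppose in addition that there exists $K_f\in\mathbb{N}$ such that for all $r\ge0$ and all $x$ the set $f^{-1}(B(x,r))$ has at most $K_f$ connected components, and that $$\sum_{n=1}^\infty\mu(B(\tilde{x},r_n))e^{-n\gamma\mu(B(\tilde{x},r_n))}=\infty$$ for some $\gamma>1$. Then $\mu(\mathcal{H}_{\mathrm{ea}})=\mu(\psi(r_n)\le M_n\text{ ev.})=0$. In particular (still under the condition on connected components), if $\mu(\phi\ge u_n)\le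 c\,\frac{\log\log n}{n}$ (for all large $n$) for some constant $c<1$, then $\mu(\mathcal{H}_{\mathrm{ea}})=\mu(u_n\le M_n\text{ ev.})=0$.
   Context: $\mathcal{X}\subset\mathbb{R}$ is an interval with the usual distance $\mathrm{dist}$, $B(x,r)=\{y\in\mathcal{X}:\mathrm{dist}(x,y)<r\}$, $[\cdot]$ is the integer part. The function $\psi\colon[0,\infty)\to\mathbb{R}\cup\{+\infty\}$ is (strictly) decreasing and continuous. Put $X_i=\phi\circ f^{i-1}$, $i\ge1$, $M_n=\max(X_1,\dots,X_n)$. $(E_n\text{ ev.})$ is the set of points belonging to $E_n$ for all large $n$. With $B_m=B(\tilde{x},r_m)$, $\mathcal{H}_{\mathrm{ea}}=\bigcup_{n\ge1}\bigcap_{m\ge n}\bigcup_{k=0}^{m-1}f^{-k}(B_m)$. Exponential decay of correlations for $\mathrm{BV}$ versus $L^\infty$: there are $C,\tau>0$ such that for all $\varphi_1$ of bounded variation, all bounded measurable $\varphi_2$ and all $j$, $|\int\varphi_1\cdot\varphi_2\circ f^j\,\mathrm{d}\mu-\int\varphi_1\,\mathrm{d}\mu\int\varphi_2\,\mathrm{d}\mu|\le Ce^{-\tau j}\|\varphi_1\|_{\mathrm{BV}}\|\varphi_2\|_\infty$, where $\|\varphi\|_{\mathrm{BV}}=\mathrm{var}(\varphi)+\sup|\varphi|$ and $\mathrm{var}$ is total variation. Condition (A2) for sequences of balls centered at $\tilde{x}$: there are $s,\gamma_0,\sigma\in(0,1)$ with $\gamma_0+s<1$ and $\sigma>\max\{\frac12(1+\gamma_0+s),1-\gamma_0,\frac13(2+s),1-\frac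 s2\}$ such that for every sequence of radii $(\rho_n)$ with $\sum_n\mu(B(\tilde{x},\rho_n))=\infty$ and $\mu(B(\tilde{x},\rho_n))=O(n^{-\sigma})$ one has $$\sum_{1\le j\le n^s}\mu\bigl(B(\tilde{x},\rho_n)\cap f^{-j}B(\tilde{x},\rho_n)\bigr)=O\bigl(n^{-1-\gamma_0}\bigr).$$
   Formalization: In the first claim of (1), it is additionally assumed that every ball around x̃ has positive μ-measure (x̃ lies in the support of μ); for x̃ off the support the series is zero but the claim is false. *)

theory Defs
  imports "HOL-Probability.Probability"
begin

definition rball :: "real set \<Rightarrow> real \<Rightarrow> real \<Rightarrow> real set" where
  "rball X x r = {y \<in> X. dist x y < r}"

definition preimage_iter :: "real set \<Rightarrow> (real \<Rightarrow> real) \<Rightarrow> nat \<Rightarrow> real set \<Rightarrow> real set" where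
  "preimage_iter X f k A = {x \<in> X. (f ^^ k) x \<in> A}"

definition invariant_measure :: "'a measure \<Rightarrow> ('a \<Rightarrow> 'a) \<Rightarrow> bool" where
  "invariant_measure M f \<longleftrightarrow> f \<in> M \<rightarrow>\<^sub>M M \<and> distr M M f = M"

definition ergodic_measure :: "'a measure \<Rightarrow> ('a \<Rightarrow> 'a) \<Rightarrow> bool" where
  "ergodic_measure M f \<longleftrightarrow> prob_space M \<and> invariant_measure M f \<and>
     (\<forall>A \<in> sets M. f -` A \<inter> space M = A \<longrightarrow> measure M A = 0 \<or> measure M A = 1)"

definition variation_sums :: "real set \<Rightarrow> (real \<Rightarrow> real) \<Rightarrow> real set" where
  "variation_sums X \<phi> =
     {(\<Sum>i<n. \<bar>\<phi> (t (Suc i)) - \<phi> (t i)\<bar>) | (n::nat) (t :: nat \<Rightarrow> real).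
        t ` {..n} \<subseteq> X \<and> mono_on {..n} t}"

definition BV_on :: "real set \<Rightarrow> (real \<Rightarrow> real) \<Rightarrow> bool" where
  "BV_on X \<phi> \<longleftrightarrow> bdd_above (variation_sums X \<phi>)"

(* The real suprema are meaningful for functions satisfying BV_on on a nonempty X. *)
definition total_variation :: "real set \<Rightarrow> (real \<Rightarrow> real) \<Rightarrow> real" where
  "total_variation X \<phi> = Sup (variation_sums X \<phi>)"

definition BV_norm :: "real set \<Rightarrow> (real \<Rightarrow> real) \<Rightarrow> real" where
  "BV_norm X \<phi> = total_variation X \<phi> + (SUP x\<in>X. \<bar>\<phi> x\<bar>)"

(* The essential supremum is finite for bounded measurable functions on a probability space. *)
definition Linf_norm :: "'a measure \<Rightarrow> ('a \<Rightarrow> real) \<Rightarrow> real" where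
  "Linf_norm M \<phi> = real_of_ereal (esssup M (\<lambda>x. ereal \<bar>\<phi> x\<bar>))"

definition exp_decay_BV_Linf :: "real measure \<Rightarrow> (real \<Rightarrow> real) \<Rightarrow> bool" where
  "exp_decay_BV_Linf M f \<longleftrightarrow>
     (\<exists>C>0. \<exists>\<tau>>0. \<forall>\<phi>1 \<phi>2 :: real \<Rightarrow> real. \<forall>j::nat.
        BV_on (space M) \<phi>1 \<longrightarrow> \<phi>2 \<in> borel_measurable M \<longrightarrow> bounded (\<phi>2 ` space M) \<longrightarrow>
        \<bar>(\<integral>x. \<phi>1 x * \<phi>2 ((f ^^ j) x) \<partial>M) - (\<integral>x. \<phi>1 x \<partial>M) * (\<integral>x. \<phi>2 x \<partial>M)\<bar>
          \<le> C * exp (- \<tau> * real j) * BV_norm (space M) \<phi>1 * Linf_norm M \<phi>2)"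

(* Sequences are indexed by n \<ge> 1; the value at 0 affects neither summability
   nor the asymptotics. *)
definition short_return_times :: "real measure \<Rightarrow> (real \<Rightarrow> real) \<Rightarrow> real \<Rightarrow> bool" where
  "short_return_times M f x0 \<longleftrightarrow>
     (\<exists>s \<gamma>0 \<sigma> :: real. s \<in> {0<..<1} \<and> \<gamma>0 \<in> {0<..<1} \<and> \<sigma> \<in> {0<..<1} \<and> \<gamma>0 + s < 1 \<and>
        \<sigma> > Max {(1 + \<gamma>0 + s) / 2, 1 - \<gamma>0, (2 + s) / 3, 1 - s / 2} \<and>
        (\<forall>\<rho> :: nat \<Rightarrow> real. (\<forall>n. \<rho> n > 0) \<longrightarrow>
           \<not> summable (\<lambda>n. measure M (rball (space M) x0 (\<rho> n))) \<longrightarrow>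
           (\<lambda>n. measure M (rball (space M) x0 (\<rho> n))) \<in> O(\<lambda>n. real n powr (- \<sigma>)) \<longrightarrow>
           (\<lambda>n. \<Sum>j \<in> {j::nat. 1 \<le> j \<and> real j \<le> real n powr s}.
                  measure M (rball (space M) x0 (\<rho> n) \<inter>
                             preimage_iter (space M) f j (rball (space M) x0 (\<rho> n))))
             \<in> O(\<lambda>n. real n powr (- 1 - \<gamma>0))))"

(* M_n = max (X_1, ..., X_n) with X_i = \<phi> o f^(i-1); meaningful for n \<ge> 1. *)
definition running_max :: "('a \<Rightarrow> ereal) \<Rightarrow> ('a \<Rightarrow> 'a) \<Rightarrow> nat \<Rightarrow> 'a \<Rightarrow> ereal" where
  "running_max \<phi> f n x = Max ((\<lambda>i. \<phi> ((f ^^ (i - 1)) x)) ` {1..n})"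

definition eventually_set :: "'a set \<Rightarrow> (nat \<Rightarrow> 'a \<Rightarrow> bool) \<Rightarrow> 'a set" where
  "eventually_set X P = {x \<in> X. \<forall>\<^sub>F n in sequentially. P n x}"

definition H_ea :: "real set \<Rightarrow> (real \<Rightarrow> real) \<Rightarrow> real \<Rightarrow> (nat \<Rightarrow> real) \<Rightarrow> real set" where
  "H_ea X f x0 r =
     (\<Union>n\<in>{1..}. \<Inter>m\<in>{n..}. \<Union>k<m. preimage_iter X f k (rball X x0 (r m)))"

end

(* Let A(N) be the set of points whose first N iterates miss a ball B of measure p. Cut the time
   interval into blocks of length t separated by gaps of length g. Since the indicator of B has
   bounded norm in BV, inclusion-exclusion inside one block and decay of correlations across one gap
   give a recursion for the measure of A(N): up to small errors every block contributes a factor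
   1 - t p. The lower bound needs only the first Bonferroni inequality; the upper bound needs the
   second one, whose error is the sum controlled by the short return times condition. Hence A(N) has
   measure close to exp (- N p).

   Part 1 follows from the upper bound by a logarithmically weighted Borel-Cantelli argument, after
   shrinking the balls so that their measures are O(n^-sigma).

   In part 2 the slack in gamma > 1 (or c < 1) yields theta < 1 and infinitely many n such that
   k p_k <= theta log log n for all k between sqrt n and n. Consider about (log n)^b, b < 1, scales
   m_i in [sqrt n, n] with m_(i+1) / m_i of order (log n)^2. Missing the ball of scale i+1 in the
   time window from D m_i to m_(i+1) has probability at least (log n)^-theta', theta' < b; these events are
   nearly independent, because the hitting set of a window is a union of at most exponentially many
   (in m_(i+1)) intervals while the gap to the next window is D m_(i+1). Hits before the
   window starts are rare. So with probability tending to 1 some scale in [sqrt n, n] is missed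
   entirely, and no zero-one law is needed. *)

theory Submission
  imports Defs "HOL-Real_Asymp.Real_Asymp"
begin

section \<open>Indicators of finite unions of intervals\<close>

text \<open>\<open>H_ea\<close> is built from open balls, the exceedance set of \<open>u n\<close>
  is a closed ball, and the return time hypothesis speaks only of sequences of balls with mass
  O(n^-\<sigma>) and divergent sum. To pass between these, every mass below that of a given ball
  must be attained by a smaller concentric ball, and boundaries must be null; atoms are the
  obstacle. Decay of correlations leaves only one way to have an atom: it carries all the mass. The
  Dirac measure is settled by hand; otherwise the mass of a ball depends continuously on its radius.

  The component condition belongs to part 2 alone because of what stands on the BV side of the
  correlation bound. In the block recursion this is always the indicator of the ball itself, and
  everything later is a mere bounded function. Decoupling a whole window from the later ones puts a
  union of preimages on the BV side, with norm up to about K^m. The exponential decay, counted from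
  time 0, has to beat this, which fixes D: exp(-\<tau> D) K must be below 1.\<close>

text \<open>Testing on finite sets is what makes this notion stable under preimages: on a finite subset of
  \<open>X\<close> every interval has the same trace as some ball, so a bound on the number of components of
  preimages of balls suffices.\<close>

definition pieces :: "real set \<Rightarrow> nat \<Rightarrow> real set \<Rightarrow> bool" where
  "pieces X m S \<longleftrightarrow> (\<forall>F\<subseteq>X. finite F \<longrightarrow>
     (\<exists>\<C>. finite \<C> \<and> card \<C> \<le> m \<and> (\<forall>J\<in>\<C>. is_interval J) \<and> S \<inter> F = \<Union>\<C> \<inter> F))"

lemma is_interval_rball:
  assumes "is_interval X" shows "is_interval (rball X x r)"
proof -
  have "rball X x r = X \<inter> {x - r<..<x + r}"
    by (auto simp: rball_def dist_real_def)
  thus ?thesis using assms by (simp add: is_interval_Int is_interval_oo)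
qed

lemma pieces_rball: "is_interval X \<Longrightarrow> pieces X 1 (rball X x r)"
  unfolding pieces_def
  by (intro allI impI exI[of _ "{rball X x r}"]) (auto intro: is_interval_rball)

lemma pieces_singleton: "pieces X 1 {x}"
  unfolding pieces_def
  by (intro allI impI exI[of _ "{{x}}"]) (auto simp: is_interval_1)

lemma pieces_UN:
  assumes "finite A" and "\<And>i. i \<in> A \<Longrightarrow> pieces X (k i) (S i)"
  shows "pieces X (\<Sum>i\<in>A. k i) (\<Union>i\<in>A. S i)"
  unfolding pieces_def
proof (intro allI impI)
  fix F assume F: "F \<subseteq> X" "finite F"
  have "\<forall>i\<in>A. \<exists>\<C>. finite \<C> \<and> card \<C> \<le> k i \<and> (\<forall>J\<in>\<C>. is_interval J) \<and> S i \<inter> F = \<Union>\<C> \<inter> F"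
    using assms(2) F unfolding pieces_def by blast
  then obtain \<C> where \<C>: "\<And>i. i \<in> A \<Longrightarrow> finite (\<C> i) \<and> card (\<C> i) \<le> k i \<and>
      (\<forall>J\<in>\<C> i. is_interval J) \<and> S i \<inter> F = \<Union>(\<C> i) \<inter> F"
    by metis
  show "\<exists>\<C>. finite \<C> \<and> card \<C> \<le> (\<Sum>i\<in>A. k i) \<and> (\<forall>J\<in>\<C>. is_interval J) \<and>
      (\<Union>i\<in>A. S i) \<inter> F = \<Union>\<C> \<inter> F"
  proof (intro exI[of _ "\<Union>i\<in>A. \<C> i"] conjI)
    show "finite (\<Union>i\<in>A. \<C> i)" using assms(1) \<C> by blast
    show "card (\<Union>i\<in>A. \<C> i) \<le> (\<Sum>i\<in>A. k i)"
      using card_UN_le[OF assms(1)] sum_mono[of A "\<lambda>i. card (\<C> i)" k] \<C> le_trans by blast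
    show "(\<Union>i\<in>A. S i) \<inter> F = \<Union>(\<Union>i\<in>A. \<C> i) \<inter> F" using \<C> by blast
  qed (use \<C> in blast)
qed

lemma pieces_mono: "pieces X m S \<Longrightarrow> m \<le> n \<Longrightarrow> pieces X n S"
  unfolding pieces_def by (meson le_trans)

text \<open>If \<open>J\<close> meets \<open>F\<close>, its trace is the part of \<open>F\<close>
  between its extreme points \<open>a\<close> and \<open>b\<close>. The ball around their midpoint
  whose radius is the distance to the nearest point of \<open>F\<close> outside
  \<open>{a..b}\<close> has the same trace, and the midpoint lies in \<open>X\<close> because
  \<open>X\<close> is an interval. This lets a hypothesis on preimages of balls speak about
  preimages of intervals.\<close>

lemma interval_trace_eq_rball_trace:
  fixes X :: "real set"
  assumes X: "is_interval X" "X \<noteq> {}" and J: "is_interval J" and F: "finite F" "F \<subseteq> X"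
  obtains x r where "x \<in> X" "r \<ge> 0" "J \<inter> F = rball X x r \<inter> F"
proof (cases "J \<inter> F = {}")
  case True
  obtain x where "x \<in> X" using X by auto
  thus ?thesis using that[of x 0] True by (auto simp: rball_def)
next
  case False
  define a b where "a = Min (J \<inter> F)" and "b = Max (J \<inter> F)"
  have fin: "finite (J \<inter> F)" using F by auto
  have a: "a \<in> J" "a \<in> F" and b: "b \<in> J" "b \<in> F"
    using Min_in[OF fin False] Max_in[OF fin False] by (auto simp: a_def b_def)
  have ab: "a \<le> y" "y \<le> b" if "y \<in> J" "y \<in> F" for y
    using that fin by (auto simp: a_def b_def)
  have J_iff: "y \<in> J \<longleftrightarrow> a \<le> y \<and> y \<le> b" if "y \<in> F" for y
    using ab[of y] that J a b unfolding is_interval_1 by blast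
  define G where "G = {y\<in>F. \<bar>y - (a+b)/2\<bar> > (b-a)/2}"
  \<comment> \<open>Without outside points any radius above half the length works.\<close>
  define r where "r = (if G = {} then (b-a)/2 + 1 else Min ((\<lambda>y. \<bar>y - (a+b)/2\<bar>) ` G))"
  have finG: "finite G" using F by (auto simp: G_def)
  have r: "r > (b-a)/2"
  proof (cases "G = {}")
    case True
    thus ?thesis by (simp add: r_def)
  next
    case False
    hence "Min ((\<lambda>y. \<bar>y - (a+b)/2\<bar>) ` G) > (b-a)/2"
      using finG by (subst Min_gr_iff) (auto simp: G_def)
    thus ?thesis using False by (simp add: r_def)
  qed
  have out: "r \<le> \<bar>y - (a+b)/2\<bar>" if "y \<in> G" for y
    using that finG by (auto simp: r_def)
  have "(a+b)/2 \<in> X"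
  proof (rule mem_is_interval_1_I[OF X(1)])
    show "a \<in> X" "b \<in> X" "a \<le> (a+b)/2" "(a+b)/2 \<le> b" using a b F ab[of b] by auto
  qed
  moreover have "J \<inter> F = rball X ((a+b)/2) r \<inter> F"
  proof -
    have "y \<in> J \<longleftrightarrow> \<bar>(a+b)/2 - y\<bar> < r" if y: "y \<in> F" for y
    proof (cases "y \<in> G")
      case True
      thus ?thesis using out[OF True] J_iff[OF y] by (auto simp: G_def abs_if field_simps split: if_splits)
    next
      case False
      hence "\<bar>y - (a+b)/2\<bar> \<le> (b-a)/2" using y by (auto simp: G_def)
      moreover from this have "a \<le> y \<and> y \<le> b" by (simp add: abs_if field_simps split: if_splits)
      ultimately show ?thesis using r J_iff[OF y] by (simp add: abs_minus_commute)
    qed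
    thus ?thesis using F by (auto simp: rball_def dist_real_def)
  qed
  moreover have "r \<ge> 0" using r ab[of b] b by auto
  ultimately show ?thesis using that by blast
qed

text \<open>On the image of \<open>F\<close> each interval agrees with a ball, and the preimage of a
  ball has at most \<open>K\<close> components, which are intervals because they are connected
  subsets of the line. The balls chosen depend on \<open>F\<close>, the count \<open>K * m\<close>
  does not.\<close>

lemma pieces_preimage:
  fixes X :: "real set"
  assumes X: "is_interval X" "X \<noteq> {}" and fX: "\<And>x. x \<in> X \<Longrightarrow> f x \<in> X"
    and K: "\<And>x r. x \<in> X \<Longrightarrow> r \<ge> 0 \<Longrightarrow> finite (components (preimage_iter X f 1 (rball X x r))) \<and>
          card (components (preimage_iter X f 1 (rball X x r))) \<le> K"
    and S: "pieces X m S"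
  shows "pieces X (K * m) {x\<in>X. f x \<in> S}"
  unfolding pieces_def
proof (intro allI impI)
  fix F assume F: "F \<subseteq> X" "finite F"
  hence fF: "f ` F \<subseteq> X" "finite (f ` F)" using fX by auto
  then obtain \<C> where \<C>: "finite \<C>" "card \<C> \<le> m" "\<And>J. J \<in> \<C> \<Longrightarrow> is_interval J"
      "S \<inter> f ` F = \<Union>\<C> \<inter> f ` F"
    using S unfolding pieces_def by meson
  have "\<forall>J\<in>\<C>. \<exists>x r. x \<in> X \<and> r \<ge> 0 \<and> J \<inter> f ` F = rball X x r \<inter> f ` F"
    using interval_trace_eq_rball_trace[OF X \<C>(3) fF(2,1)] by metis
  then obtain c r where cr: "\<And>J. J \<in> \<C> \<Longrightarrow> c J \<in> X \<and> r J \<ge> 0 \<and> J \<inter> f ` F = rball X (c J) (r J) \<inter> f ` F"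
    by metis
  define P where "P J = preimage_iter X f 1 (rball X (c J) (r J))" for J
  show "\<exists>\<C>. finite \<C> \<and> card \<C> \<le> K * m \<and> (\<forall>J\<in>\<C>. is_interval J) \<and> {x\<in>X. f x \<in> S} \<inter> F = \<Union>\<C> \<inter> F"
  proof (intro exI[of _ "\<Union>J\<in>\<C>. components (P J)"] conjI ballI)
    show "finite (\<Union>J\<in>\<C>. components (P J))"
      using \<C>(1) cr K by (auto simp: P_def)
    have "card (\<Union>J\<in>\<C>. components (P J)) \<le> (\<Sum>J\<in>\<C>. card (components (P J)))"
      by (rule card_UN_le[OF \<C>(1)])
    also have "\<dots> \<le> (\<Sum>J\<in>\<C>. K)" using cr K by (intro sum_mono) (auto simp: P_def)
    also have "\<dots> \<le> K * m" using \<C>(2) by simp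
    finally show "card (\<Union>J\<in>\<C>. components (P J)) \<le> K * m" .
    show "is_interval I" if "I \<in> (\<Union>J\<in>\<C>. components (P J))" for I
      using that in_components_connected by (auto simp: is_interval_connected_1)
    have "x \<in> F \<Longrightarrow> f x \<in> S \<longleftrightarrow> (\<exists>J\<in>\<C>. x \<in> P J)" for x
    proof -
      assume x: "x \<in> F"
      have "f x \<in> S \<longleftrightarrow> f x \<in> \<Union>\<C>" using x \<C>(4) by blast
      also have "\<dots> \<longleftrightarrow> (\<exists>J\<in>\<C>. f x \<in> rball X (c J) (r J))" using x cr by blast
      also have "\<dots> \<longleftrightarrow> (\<exists>J\<in>\<C>. x \<in> P J)" using x F by (auto simp: P_def preimage_iter_def)
      finally show ?thesis .
    qed
    moreover have "\<Union>(\<Union>J\<in>\<C>. components (P J)) = (\<Union>J\<in>\<C>. P J)"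
      using Union_components by blast
    ultimately show "{x\<in>X. f x \<in> S} \<inter> F = \<Union>(\<Union>J\<in>\<C>. components (P J)) \<inter> F"
      using F(1) by auto
  qed
qed

section \<open>Total variation and BV norm of indicators\<close>

lemma variation_upset:
  fixes t :: "nat \<Rightarrow> real"
  assumes U: "\<And>x y. x \<in> U \<Longrightarrow> x \<le> y \<Longrightarrow> y \<in> U" and t: "mono_on {..n} t"
  shows "(\<Sum>i<n. \<bar>indicator U (t (Suc i)) - indicator U (t i)\<bar>) \<le> (1::real)"
proof -
  have "(\<Sum>i<n. \<bar>indicator U (t (Suc i)) - indicator U (t i)\<bar>) =
      (\<Sum>i<n. indicator U (t (Suc i)) - (indicator U (t i) :: real))"
  proof (intro sum.cong refl)
    fix i assume "i \<in> {..<n}"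
    hence "t i \<le> t (Suc i)" by (intro mono_onD[OF t]) auto
    thus "\<bar>indicator U (t (Suc i)) - indicator U (t i)\<bar> = indicator U (t (Suc i)) - (indicator U (t i) :: real)"
      using U[of "t i" "t (Suc i)"] by (auto simp: indicator_def)
  qed
  also have "\<dots> = indicator U (t n) - indicator U (t 0)" by (rule sum_lessThan_telescope)
  also have "\<dots> \<le> 1" by (auto simp: indicator_def)
  finally show ?thesis .
qed

text \<open>An interval is the difference of two nested upper sets, and the indicator of an upper
  set is monotone, so each of the two contributes at most 1.\<close>

lemma variation_interval:
  fixes t :: "nat \<Rightarrow> real"
  assumes J: "is_interval J" and t: "mono_on {..n} t"
  shows "(\<Sum>i<n. \<bar>indicator J (t (Suc i)) - indicator J (t i)\<bar>) \<le> (2::real)"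
proof -
  define U where "U = {y. \<exists>x\<in>J. x \<le> y}"
  define V where "V = U - J"
  have U: "x \<in> U \<Longrightarrow> x \<le> y \<Longrightarrow> y \<in> U" for x y unfolding U_def mem_Collect_eq by (meson order_trans)
  have V: "x \<in> V \<Longrightarrow> x \<le> y \<Longrightarrow> y \<in> V" for x y
    using U[of x y] J unfolding is_interval_1 V_def U_def by blast
  have "indicator J x = indicator U x - (indicator V x :: real)" for x
    by (force simp: indicator_def V_def U_def)
  hence "(\<Sum>i<n. \<bar>indicator J (t (Suc i)) - indicator J (t i)\<bar>) \<le>
      (\<Sum>i<n. \<bar>indicator U (t (Suc i)) - indicator U (t i)\<bar> + \<bar>indicator V (t (Suc i)) - (indicator V (t i) :: real)\<bar>)"
    by (intro sum_mono) auto
  also have "\<dots> \<le> 1 + 1"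
    unfolding sum.distrib
    by (rule add_mono[OF variation_upset[of U, OF U t] variation_upset[of V, OF V t]])
  finally show ?thesis by simp
qed

lemma indicator_Union_diff:
  assumes "finite \<C>"
  shows "\<bar>indicator (\<Union>\<C>) a - indicator (\<Union>\<C>) b\<bar> \<le> (\<Sum>J\<in>\<C>. \<bar>indicator J a - (indicator J b :: real)\<bar>)"
proof (cases "(a \<in> \<Union>\<C>) = (b \<in> \<Union>\<C>)")
  case True
  thus ?thesis by (auto simp: indicator_def intro!: sum_nonneg)
next
  case False
  then obtain J where J: "J \<in> \<C>" "(a \<in> J) \<noteq> (b \<in> J)" by blast
  have "\<bar>indicator (\<Union>\<C>) a - indicator (\<Union>\<C>) b\<bar> = (1::real)"
    using False by (auto simp: indicator_def)
  also have "\<dots> = \<bar>indicator J a - (indicator J b :: real)\<bar>" using J by (auto simp: indicator_def)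
  also have "\<dots> \<le> (\<Sum>J\<in>\<C>. \<bar>indicator J a - (indicator J b :: real)\<bar>)"
    by (rule member_le_sum[OF J(1) _ assms]) auto
  finally show ?thesis .
qed

text \<open>A variation sum evaluates the function at finitely many points only, so \<open>S\<close>
  may be replaced by a finite union of intervals with the same trace on them.\<close>

lemma variation_pieces:
  assumes S: "pieces X m S" and s: "s \<in> variation_sums X (indicator S)"
  shows "s \<le> 2 * real m"
proof -
  obtain n t where s: "s = (\<Sum>i<n. \<bar>indicator S (t (Suc i)) - indicator S (t i)\<bar>)"
    and t: "t ` {..n} \<subseteq> X" "mono_on {..n} t"
    using s by (auto simp: variation_sums_def)
  then obtain \<C> where \<C>: "finite \<C>" "card \<C> \<le> m" "\<And>J. J \<in> \<C> \<Longrightarrow> is_interval J"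
      "S \<inter> t ` {..n} = \<Union>\<C> \<inter> t ` {..n}"
    using S unfolding pieces_def by (meson finite_atMost finite_imageI)
  have eq: "indicator S (t i) = (indicator (\<Union>\<C>) (t i) :: real)" if "i \<le> n" for i
    using \<C>(4) that by (auto simp: indicator_def)
  have "s = (\<Sum>i<n. \<bar>indicator (\<Union>\<C>) (t (Suc i)) - indicator (\<Union>\<C>) (t i)\<bar>)"
    unfolding s by (intro sum.cong) (auto simp: eq)
  also have "\<dots> \<le> (\<Sum>i<n. \<Sum>J\<in>\<C>. \<bar>indicator J (t (Suc i)) - indicator J (t i)\<bar>)"
    by (intro sum_mono indicator_Union_diff \<C>(1))
  also have "\<dots> = (\<Sum>J\<in>\<C>. \<Sum>i<n. \<bar>indicator J (t (Suc i)) - indicator J (t i)\<bar>)"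
    by (rule sum.swap)
  also have "\<dots> \<le> (\<Sum>J\<in>\<C>. 2)" by (intro sum_mono variation_interval t \<C>(3))
  also have "\<dots> \<le> 2 * real m" using \<C>(2) by simp
  finally show ?thesis .
qed

lemma zero_in_variation_sums: "X \<noteq> {} \<Longrightarrow> 0 \<in> variation_sums X \<phi>"
  unfolding variation_sums_def
  by (auto intro!: exI[of _ 0] exI[of _ "\<lambda>_. SOME x. x \<in> X"] mono_onI simp: some_in_eq)

lemma BV_on_pieces: "pieces X m S \<Longrightarrow> BV_on X (indicator S)"
  unfolding BV_on_def using variation_pieces by (auto intro!: bdd_aboveI)

lemma BV_norm_pieces:
  assumes S: "pieces X m S" and X: "X \<noteq> {}"
  shows "BV_norm X (indicator S) \<le> 2 * real m + 1" "0 \<le> BV_norm X (indicator S)"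
proof -
  have "total_variation X (indicator S) \<le> 2 * real m"
    unfolding total_variation_def using zero_in_variation_sums[OF X] variation_pieces[OF S]
    by (intro cSup_least) auto
  moreover have "(SUP x\<in>X. \<bar>indicator S x :: real\<bar>) \<le> 1"
    using X by (intro cSUP_least) (auto simp: indicator_def)
  ultimately show "BV_norm X (indicator S) \<le> 2 * real m + 1" by (simp add: BV_norm_def)
  have "0 \<le> total_variation X (indicator S)"
    unfolding total_variation_def using zero_in_variation_sums[OF X] BV_on_pieces[OF S]
    by (intro cSup_upper) (auto simp: BV_on_def)
  moreover obtain x where "x \<in> X" using X by auto
  then have "0 \<le> (SUP x\<in>X. \<bar>indicator S x :: real\<bar>)"
    by (intro cSUP_upper2[of _ _ x]) (auto intro!: bdd_aboveI[of _ 1] simp: indicator_def)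
  ultimately show "0 \<le> BV_norm X (indicator S)" by (simp add: BV_norm_def)
qed

lemma Linf_norm_indicator_le:
  assumes "E \<in> sets M"
  shows "Linf_norm M (indicator E) \<le> 1"
proof -
  have "esssup M (\<lambda>x. ereal \<bar>indicator E x\<bar>) \<le> 1"
    using assms by (intro esssup_I) (auto simp: indicator_def)
  thus ?thesis unfolding Linf_norm_def
    \<comment> \<open>The case split admits the value minus infinity, which
      \<open>real_of_ereal\<close> sends to 0.\<close>
    by (cases "esssup M (\<lambda>x. ereal \<bar>indicator E x\<bar>)") (auto simp: one_ereal_def)
qed

section \<open>Decay of correlations for indicators\<close>

locale decay_system = prob_space M for M :: "real measure" +
  fixes X :: "real set" and f :: "real \<Rightarrow> real" and C \<tau> :: real
  assumes interval_X: "is_interval X"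
    and sets_M: "sets M = sets (restrict_space borel X)"
    and f_measurable: "f \<in> M \<rightarrow>\<^sub>M M"
    and f_invariant: "distr M M f = M"
    and C_pos: "C > 0" and \<tau>_pos: "\<tau> > 0"
    and decay: "\<And>\<phi>1 \<phi>2 j. BV_on X \<phi>1 \<Longrightarrow> \<phi>2 \<in> borel_measurable M \<Longrightarrow> bounded (\<phi>2 ` X) \<Longrightarrow>
      \<bar>(\<integral>x. \<phi>1 x * \<phi>2 ((f ^^ j) x) \<partial>M) - (\<integral>x. \<phi>1 x \<partial>M) * (\<integral>x. \<phi>2 x \<partial>M)\<bar>
          \<le> C * exp (- \<tau> * real j) * BV_norm X \<phi>1 * Linf_norm M \<phi>2"
begin

lemma space_M: "space M = X"
  using sets_eq_imp_space_eq[OF sets_M] by (simp add: space_restrict_space)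

lemma X_nonempty: "X \<noteq> {}"
  using not_empty space_M by simp

lemma Int_borel_sets: "A \<in> sets borel \<Longrightarrow> X \<inter> A \<in> sets M"
  by (auto simp: sets_M sets_restrict_space)

lemma sets_subset_X: "A \<in> sets M \<Longrightarrow> A \<subseteq> X"
  using sets.sets_into_space space_M by auto

lemma funpow_measurable [measurable]: "f ^^ k \<in> M \<rightarrow>\<^sub>M M"
  by (induction k) (auto intro: measurable_compose[OF _ f_measurable] simp: comp_def)

lemma funpow_in_X: "x \<in> X \<Longrightarrow> (f ^^ k) x \<in> X"
  using measurable_space[OF funpow_measurable] space_M by auto

lemma preimage_sets [measurable]: "A \<in> sets M \<Longrightarrow> preimage_iter X f k A \<in> sets M"
  using measurable_sets[OF funpow_measurable, of A k]
  by (simp add: preimage_iter_def space_M vimage_def Int_def conj_commute)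

lemma distr_funpow: "distr M M (f ^^ k) = M"
proof (induction k)
  case 0
  show ?case by (simp add: distr_id id_def)
next
  case (Suc k)
  have "distr M M (f ^^ Suc k) = distr (distr M M (f ^^ k)) M f"
    by (subst distr_distr) (auto simp: f_measurable comp_def)
  also have "\<dots> = M" unfolding Suc by (rule f_invariant)
  finally show ?case .
qed

lemma measure_preimage:
  assumes "A \<in> sets M"
  shows "measure M (preimage_iter X f k A) = measure M A"
proof -
  have "measure M A = measure (distr M M (f ^^ k)) A" by (simp add: distr_funpow)
  also have "\<dots> = measure M ((f ^^ k) -` A \<inter> space M)"
    using assms by (intro measure_distr) auto
  also have "(f ^^ k) -` A \<inter> space M = preimage_iter X f k A"
    by (auto simp: preimage_iter_def space_M)
  finally show ?thesis by simp
qed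

lemma preimage_preimage:
  "preimage_iter X f k (preimage_iter X f l A) = preimage_iter X f (l + k) A"
  using funpow_in_X by (auto simp: preimage_iter_def funpow_add)

lemma preimage_Int: "preimage_iter X f k (A \<inter> B) = preimage_iter X f k A \<inter> preimage_iter X f k B"
  by (auto simp: preimage_iter_def)

text \<open>The cost is linear in the number of intervals. Only the sup norm of the second function
  enters, so \<open>E\<close> may encode the whole future of the orbit from time \<open>j\<close>
  on.\<close>

lemma correlation:
  assumes S: "pieces X m S" "S \<in> sets M" and E: "E \<in> sets M"
  shows "\<bar>measure M (S \<inter> preimage_iter X f j E) - measure M S * measure M E\<bar>
    \<le> C * exp (- \<tau> * real j) * (2 * real m + 1)"
proof -
  have "(\<integral>x. indicator S x * indicator E ((f ^^ j) x) \<partial>M) =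
      (\<integral>x. indicator (S \<inter> preimage_iter X f j E) x \<partial>M :: real)"
    by (intro Bochner_Integration.integral_cong refl) (simp add: indicator_def preimage_iter_def space_M)
  also have "\<dots> = measure M (S \<inter> preimage_iter X f j E)"
    using S E by simp
  finally have 1: "(\<integral>x. indicator S x * indicator E ((f ^^ j) x) \<partial>M :: real) =
      measure M (S \<inter> preimage_iter X f j E)" .
  have bnd: "bounded (indicator E ` X :: real set)"
    by (auto intro!: boundedI[of _ 1] simp: indicator_def)
  have "\<bar>measure M (S \<inter> preimage_iter X f j E) - measure M S * measure M E\<bar> \<le>
      C * exp (- \<tau> * real j) * BV_norm X (indicator S) * Linf_norm M (indicator E)"
    using decay[OF BV_on_pieces[OF S(1)] _ bnd, of j] S E by (simp add: 1)
  also have "\<dots> \<le> C * exp (- \<tau> * real j) * BV_norm X (indicator S) * 1"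
    using C_pos BV_norm_pieces[OF S(1) X_nonempty] Linf_norm_indicator_le[OF E]
    by (intro mult_left_mono) auto
  also have "\<dots> \<le> C * exp (- \<tau> * real j) * (2 * real m + 1)"
    using C_pos BV_norm_pieces[OF S(1) X_nonempty] by (simp add: mult_left_mono)
  finally show ?thesis .
qed

end

section \<open>Block estimates\<close>

text \<open>Adding \<open>A t\<close> to the union so far loses at most the sum of its overlaps with
  the earlier sets.\<close>

lemma (in finite_measure) bonferroni_lower:
  fixes t :: nat
  assumes "\<And>j. j < t \<Longrightarrow> A j \<in> sets M"
  shows "measure M (\<Union>j<t. A j) \<ge> (\<Sum>j<t. measure M (A j)) - (\<Sum>j<t. \<Sum>i<j. measure M (A i \<inter> A j))"
  using assms
proof (induction t)
  case (Suc t)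
  have [measurable]: "A j \<in> sets M" if "j \<le> t" for j using Suc.prems that by auto
  define U where "U = (\<Union>j<t. A j)"
  have U: "U \<in> sets M" by (auto simp: U_def)
  have "measure M (\<Union>j<Suc t. A j) = measure M (U \<union> A t)"
    by (simp add: U_def lessThan_Suc Un_commute)
  also have "\<dots> = measure M U + measure M (A t) - measure M (U \<inter> A t)"
    using U by (simp add: measure_Un3 fmeasurable_eq_sets)
  finally have "measure M (\<Union>j<Suc t. A j) = measure M U + measure M (A t) - measure M (U \<inter> A t)" .
  moreover have "measure M (U \<inter> A t) \<le> (\<Sum>i<t. measure M (A i \<inter> A t))"
  proof -
    have "U \<inter> A t = (\<Union>i<t. A i \<inter> A t)" by (auto simp: U_def)
    thus ?thesis by (simp only:) (intro finite_measure_subadditive_finite, auto)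
  qed
  ultimately show ?case using Suc by (simp add: U_def)
qed auto

context decay_system begin

text \<open>The times are 0, ..., N - 1, matching the observables X_1, ..., X_N.\<close>

definition no_hit :: "real set \<Rightarrow> nat \<Rightarrow> real set" where
  "no_hit S N = {x\<in>X. \<forall>k<N. (f ^^ k) x \<notin> S}"

lemma no_hit_eq: "no_hit S N = X - (\<Union>k<N. preimage_iter X f k S)"
  by (auto simp: no_hit_def preimage_iter_def)

lemma X_sets [measurable]: "X \<in> sets M"
  using sets.top[of M] by (simp add: space_M)

lemma no_hit_sets [measurable]: "S \<in> sets M \<Longrightarrow> no_hit S N \<in> sets M"
  unfolding no_hit_eq by auto

lemma no_hit_mono: "S \<subseteq> S' \<Longrightarrow> N \<le> N' \<Longrightarrow> no_hit S' N' \<subseteq> no_hit S N"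
  by (auto simp: no_hit_def) 

lemma no_hit_add: "no_hit S (a + b) = no_hit S a \<inter> preimage_iter X f a (no_hit S b)"
proof -
  have "(\<forall>k<a+b. (f ^^ k) x \<notin> S) \<longleftrightarrow> (\<forall>k<a. (f ^^ k) x \<notin> S) \<and> (\<forall>k<b. (f ^^ k) ((f ^^ a) x) \<notin> S)" for x
  proof -
    have "(\<forall>k<b. (f ^^ k) ((f ^^ a) x) \<notin> S) \<longleftrightarrow> (\<forall>k\<in>{a..<a+b}. (f ^^ k) x \<notin> S)"
    proof safe
      fix k assume "\<forall>k<b. (f ^^ k) ((f ^^ a) x) \<notin> S" "k \<in> {a..<a+b}" "(f ^^ k) x \<in> S"
      hence "(f ^^ (k - a)) ((f ^^ a) x) \<notin> S" "(f ^^ (k - a + a)) x \<in> S" by auto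
      thus False by (simp only: funpow_add comp_def)
    next
      fix k assume "\<forall>k\<in>{a..<a+b}. (f ^^ k) x \<notin> S" "k < b" "(f ^^ k) ((f ^^ a) x) \<in> S"
      moreover from this(3) have "(f ^^ (k + a)) x \<in> S" by (simp only: funpow_add comp_def)
      ultimately show False by auto
    qed
    thus ?thesis by (metis atLeastLessThan_iff not_less trans_less_add1)
  qed
  thus ?thesis using funpow_in_X by (auto simp: no_hit_def preimage_iter_def)
qed

lemma prob_preimage_Int:
  assumes "i \<le> j" "A \<in> sets M" "B \<in> sets M"
  shows "prob (preimage_iter X f i A \<inter> preimage_iter X f j B) = prob (A \<inter> preimage_iter X f (j - i) B)"
proof -
  have "preimage_iter X f i A \<inter> preimage_iter X f j B = preimage_iter X f i (A \<inter> preimage_iter X f (j - i) B)"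
    using assms(1) by (simp add: preimage_Int preimage_preimage)
  thus ?thesis using assms by (simp add: measure_preimage)
qed

text \<open>By invariance both times can be moved back by \<open>j\<close>; their distance
  \<open>t + g - j\<close> is still at least \<open>g\<close>. The factor 3 is
  \<open>2 * m + 1\<close> for a single interval.\<close>

lemma correlation_shifted:
  assumes B: "pieces X 1 B" "B \<in> sets M" and E: "E \<in> sets M" and j: "j < t"
  shows "\<bar>prob (preimage_iter X f j B \<inter> preimage_iter X f (t + g) E) - prob B * prob E\<bar>
     \<le> 3 * C * exp (- \<tau> * real g)"
proof -
  have "prob (preimage_iter X f j B \<inter> preimage_iter X f (t + g) E) = prob (B \<inter> preimage_iter X f (t + g - j) E)"
    using j B E by (intro prob_preimage_Int) auto
  moreover have "\<bar>prob (B \<inter> preimage_iter X f (t + g - j) E) - prob B * prob E\<bar>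
      \<le> C * exp (- \<tau> * real (t + g - j)) * (2 * real 1 + 1)"
    using B E by (intro correlation)
  moreover have "exp (- \<tau> * real (t + g - j)) \<le> exp (- \<tau> * real g)"
    using \<tau>_pos j by simp
  then have "C * exp (- \<tau> * real (t + g - j)) * (2 * real 1 + 1) \<le> 3 * C * exp (- \<tau> * real g)"
    using C_pos by simp
  ultimately show ?thesis by linarith
qed

text \<open>Only \<open>B\<close> itself enters as an observable of bounded variation, so no control on the preimages of
  \<open>B\<close> is needed.\<close>

lemma no_hit_block_upper:
  assumes B: "pieces X 1 B" "B \<in> sets M" and E: "E \<in> sets M"
  shows "prob (no_hit B t \<inter> preimage_iter X f (t + g) E) \<le> (1 - real t * prob B) * prob E +
    real t * (3 * C * exp (- \<tau> * real g) + (\<Sum>j=1..t. prob (B \<inter> preimage_iter X f j B)))"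
proof -
  note [measurable] = B(2) E
  define E' where "E' = preimage_iter X f (t + g) E"
  have E' [measurable]: "E' \<in> sets M" by (simp add: E'_def)
  define h where "h j = preimage_iter X f j B \<inter> E'" for j
  define S where "S = (\<Sum>j=1..t. prob (B \<inter> preimage_iter X f j B))"
  have h [measurable]: "h j \<in> sets M" for j by (simp add: h_def)
  have E'X: "E' \<subseteq> X" by (auto simp: E'_def preimage_iter_def)
  have "prob (\<Union>j<t. h j) \<ge> (\<Sum>j<t. prob (h j)) - (\<Sum>j<t. \<Sum>i<j. prob (h i \<inter> h j))"
    by (rule bonferroni_lower) auto
  moreover have "(\<Sum>j<t. prob (h j)) \<ge> (\<Sum>j<t. prob B * prob E - 3 * C * exp (- \<tau> * real g))"
  proof (intro sum_mono)
    fix j assume "j \<in> {..<t}"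
    thus "prob B * prob E - 3 * C * exp (- \<tau> * real g) \<le> prob (h j)"
      using correlation_shifted[OF B E, of j t g] by (simp add: h_def E'_def abs_le_iff)
  qed
  \<comment> \<open>\<open>E'\<close> is dropped, and by invariance the remaining overlap depends
    only on the lag \<open>j - i\<close>. For fixed \<open>j\<close> the lags are distinct and lie
    in \<open>{1..t}\<close>.\<close>
  moreover have "(\<Sum>j<t. \<Sum>i<j. prob (h i \<inter> h j)) \<le> (\<Sum>j<t. S)"
  proof (intro sum_mono)
    fix j assume j: "j \<in> {..<t}"
    have "(\<Sum>i<j. prob (h i \<inter> h j)) \<le> (\<Sum>i<j. prob (B \<inter> preimage_iter X f (j - i) B))"
    proof (intro sum_mono)
      fix i assume i: "i \<in> {..<j}"
      have "prob (h i \<inter> h j) \<le> prob (preimage_iter X f i B \<inter> preimage_iter X f j B)"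
        by (intro finite_measure_mono) (auto simp: h_def)
      also have "\<dots> = prob (B \<inter> preimage_iter X f (j - i) B)"
        using i B by (intro prob_preimage_Int) auto
      finally show "prob (h i \<inter> h j) \<le> prob (B \<inter> preimage_iter X f (j - i) B)" .
    qed
    also have "\<dots> = (\<Sum>l=1..j. prob (B \<inter> preimage_iter X f l B))"
      by (rule sum.reindex_bij_witness[of _ "\<lambda>l. j - l" "\<lambda>i. j - i"]) auto
    also have "\<dots> \<le> S" unfolding S_def using j by (intro sum_mono2) auto
    finally show "(\<Sum>i<j. prob (h i \<inter> h j)) \<le> S" .
  qed
  moreover have "prob (no_hit B t \<inter> E') = prob (E' - (\<Union>j<t. h j))"
    using E'X by (intro arg_cong[of _ _ prob]) (auto simp: no_hit_eq h_def)
  moreover have "\<dots> = prob E' - prob (\<Union>j<t. h j)"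
    by (intro finite_measure_Diff) (auto simp: h_def)
  moreover have "prob E' = prob E" by (simp add: E'_def measure_preimage)
  ultimately show ?thesis
    unfolding S_def[symmetric] E'_def[symmetric] by (simp add: sum_subtractf algebra_simps)
qed

text \<open>Hits in the first \<open>t\<close> steps are decoupled from \<open>E\<close> across the
  gap. Hits inside the gap come too close to \<open>E\<close> for that and are charged with their
  full measure \<open>g * prob B\<close>.\<close>

lemma no_hit_block_lower:
  assumes B: "pieces X 1 B" "B \<in> sets M" and E: "E \<in> sets M"
  shows "prob (no_hit B (t + g) \<inter> preimage_iter X f (t + g) E) \<ge> (1 - real t * prob B) * prob E -
    (real t * (3 * C * exp (- \<tau> * real g)) + real g * prob B)"
proof -
  note [measurable] = B(2) E
  define E' where "E' = preimage_iter X f (t + g) E"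
  have E' [measurable]: "E' \<in> sets M" by (simp add: E'_def)
  have E'X: "E' \<subseteq> X" by (auto simp: E'_def preimage_iter_def)
  have "prob E' \<le> prob ((no_hit B (t + g) \<inter> E') \<union> ((\<Union>j<t. preimage_iter X f j B \<inter> E') \<union>
      (\<Union>j\<in>{t..<t+g}. preimage_iter X f j B)))"
  proof (intro finite_measure_mono subsetI)
    fix x assume x: "x \<in> E'"
    show "x \<in> (no_hit B (t + g) \<inter> E') \<union> ((\<Union>j<t. preimage_iter X f j B \<inter> E') \<union>
      (\<Union>j\<in>{t..<t+g}. preimage_iter X f j B))"
    proof (cases "x \<in> no_hit B (t + g)")
      case False
      then obtain k where "k < t + g" "x \<in> preimage_iter X f k B"
        using x E'X by (auto simp: no_hit_def preimage_iter_def)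
      thus ?thesis using x by (cases "k < t") auto
    qed (use x in auto)
  qed auto
  also have "\<dots> \<le> prob (no_hit B (t + g) \<inter> E') + prob ((\<Union>j<t. preimage_iter X f j B \<inter> E') \<union>
      (\<Union>j\<in>{t..<t+g}. preimage_iter X f j B))"
    by (intro measure_Un_le) auto
  also have "prob ((\<Union>j<t. preimage_iter X f j B \<inter> E') \<union> (\<Union>j\<in>{t..<t+g}. preimage_iter X f j B)) \<le>
      prob (\<Union>j<t. preimage_iter X f j B \<inter> E') + prob (\<Union>j\<in>{t..<t+g}. preimage_iter X f j B)"
    by (intro measure_Un_le) auto
  also have "prob (\<Union>j<t. preimage_iter X f j B \<inter> E') \<le> (\<Sum>j<t. prob (preimage_iter X f j B \<inter> E'))"
    by (intro finite_measure_subadditive_finite) auto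
  also have "\<dots> \<le> (\<Sum>j<t. prob B * prob E + 3 * C * exp (- \<tau> * real g))"
  proof (intro sum_mono)
    fix j assume "j \<in> {..<t}"
    thus "prob (preimage_iter X f j B \<inter> E') \<le> prob B * prob E + 3 * C * exp (- \<tau> * real g)"
      using correlation_shifted[OF B E, of j t g] by (simp add: E'_def abs_le_iff)
  qed
  also have "prob (\<Union>j\<in>{t..<t+g}. preimage_iter X f j B) \<le> (\<Sum>j\<in>{t..<t+g}. prob (preimage_iter X f j B))"
    by (intro finite_measure_subadditive_finite) auto
  also have "\<dots> = real g * prob B" by (simp add: measure_preimage)
  finally show ?thesis
    by (simp add: E'_def measure_preimage sum.distrib algebra_simps)
qed

text \<open>The first block is split off and the rest of the orbit plays the role of
  \<open>E\<close>; for an upper bound the gap may be forgotten. Since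
  \<open>t * prob B \<le> 1\<close>, the factor of a block lies in [0, 1], so the induction
  hypothesis can be multiplied by it and the errors merely add up.\<close>

lemma no_hit_upper:
  assumes B: "pieces X 1 B" "B \<in> sets M" and tp: "real t * prob B \<le> 1"
  shows "prob (no_hit B (q * (t + g))) \<le> (1 - real t * prob B) ^ q +
    real q * (real t * (3 * C * exp (- \<tau> * real g) + (\<Sum>j=1..t. prob (B \<inter> preimage_iter X f j B))))"
    (is "_ \<le> _ + real q * ?e")
proof (induction q)
  case (Suc q)
  have "0 \<le> (\<Sum>j=1..t. prob (B \<inter> preimage_iter X f j B))" by (intro sum_nonneg) auto
  hence e: "0 \<le> ?e" using C_pos by simp
  have "prob (no_hit B (Suc q * (t + g))) = prob (no_hit B ((t + g) + q * (t + g)))" by simp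
  also have "\<dots> \<le> prob (no_hit B t \<inter> preimage_iter X f (t + g) (no_hit B (q * (t + g))))"
    using B no_hit_mono[of B B t "t + g"] by (subst no_hit_add) (intro finite_measure_mono, auto)
  also have "\<dots> \<le> (1 - real t * prob B) * prob (no_hit B (q * (t + g))) + ?e"
    using B by (intro no_hit_block_upper) auto
  also have "\<dots> \<le> (1 - real t * prob B) * ((1 - real t * prob B) ^ q + real q * ?e) + ?e"
    using tp by (intro add_right_mono mult_left_mono Suc.IH) auto
  also have "\<dots> = (1 - real t * prob B) ^ Suc q + (1 - real t * prob B) * (real q * ?e) + ?e"
    by (simp add: ring_distribs)
  also have "(1 - real t * prob B) * (real q * ?e) \<le> 1 * (real q * ?e)"
    using e by (intro mult_right_mono) auto
  finally show ?case by (simp add: algebra_simps)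
qed auto

lemma no_hit_lower:
  assumes B: "pieces X 1 B" "B \<in> sets M" and tp: "real t * prob B \<le> 1"
  shows "prob (no_hit B (q * (t + g))) \<ge> (1 - real t * prob B) ^ q -
    real q * (real t * (3 * C * exp (- \<tau> * real g)) + real g * prob B)"
    (is "_ \<ge> _ - real q * ?e")
proof (induction q)
  case 0
  have "no_hit B 0 = space M" by (auto simp: no_hit_def space_M)
  thus ?case using prob_space by simp
next
  case (Suc q)
  have e: "0 \<le> ?e" using C_pos by simp
  have "(1 - real t * prob B) * (real q * ?e) \<le> 1 * (real q * ?e)"
    using e by (intro mult_right_mono) auto
  hence "(1 - real t * prob B) ^ Suc q - real (Suc q) * ?e \<le>
      (1 - real t * prob B) ^ Suc q - (1 - real t * prob B) * (real q * ?e) - ?e"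
    by (simp add: algebra_simps)
  also have "\<dots> = (1 - real t * prob B) * ((1 - real t * prob B) ^ q - real q * ?e) - ?e"
    by (simp add: ring_distribs)
  also have "\<dots> \<le> (1 - real t * prob B) * prob (no_hit B (q * (t + g))) - ?e"
    using tp by (intro diff_right_mono mult_left_mono Suc.IH) auto
  also have "\<dots> \<le> prob (no_hit B (t + g) \<inter> preimage_iter X f (t + g) (no_hit B (q * (t + g))))"
    using B by (intro no_hit_block_lower) auto
  also have "\<dots> = prob (no_hit B (Suc q * (t + g)))"
    by (simp add: no_hit_add)
  finally show ?case .
qed

end

section \<open>Atoms\<close>

context decay_system begin

lemma singleton_sets: "p \<in> X \<Longrightarrow> {p} \<in> sets M"
  using Int_borel_sets[of "{p}"] by (simp add: Int_absorb1)

lemma rball_sets [measurable]: "rball X x r \<in> sets M"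
proof -
  have "rball X x r = X \<inter> ball x r" by (auto simp: rball_def)
  thus ?thesis using Int_borel_sets[of "ball x r"] by simp
qed

lemma exp_decay_tendsto_0: "(\<lambda>j. C * exp (- \<tau> * real j) * 3) \<longlonglongrightarrow> 0"
  using \<tau>_pos by real_asymp

text \<open>Correlating \<open>{p}\<close> with itself, the limit \<open>m * m > 0\<close> forces
  \<open>p\<close> to return to itself at every large time. Two consecutive return times make
  \<open>p\<close> a fixed point, and then the correlation is constantly \<open>m - m * m\<close>,
  which must vanish.\<close>

lemma atom_imp_dirac:
  assumes p: "p \<in> X" "prob {p} \<noteq> 0"
  shows "prob {p} = 1"
proof -
  define m where "m = prob {p}"
  have m: "m > 0" using p(2) measure_nonneg[of M "{p}"] unfolding m_def by linarith
  have corr: "\<bar>prob ({p} \<inter> preimage_iter X f j {p}) - m * m\<bar> \<le> C * exp (- \<tau> * real j) * 3" for j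
    using correlation[OF pieces_singleton singleton_sets[OF p(1)] singleton_sets[OF p(1)], of j]
    by (simp add: m_def)
  have "eventually (\<lambda>j. C * exp (- \<tau> * real j) * 3 < m * m) sequentially"
    using order_tendstoD(2)[OF exp_decay_tendsto_0, of "m * m"] m by simp
  then obtain J where J: "\<And>j. j \<ge> J \<Longrightarrow> C * exp (- \<tau> * real j) * 3 < m * m"
    by (auto simp: eventually_sequentially)
  have ret: "(f ^^ j) p = p" if "j \<ge> J" for j
  proof (rule ccontr)
    assume "(f ^^ j) p \<noteq> p"
    hence "{p} \<inter> preimage_iter X f j {p} = {}" by (auto simp: preimage_iter_def)
    hence "prob ({p} \<inter> preimage_iter X f j {p}) = 0" by (simp only: measure_empty)
    thus False using corr[of j] J[OF that] by simp
  qed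
  have fp: "f p = p" using ret[of J] ret[of "Suc J"] by simp
  have fixed: "(f ^^ j) p = p" for j by (induction j) (auto simp: fp)
  hence "{p} \<inter> preimage_iter X f j {p} = {p}" for j using p(1) by (auto simp: preimage_iter_def)
  hence "\<bar>m - m * m\<bar> \<le> C * exp (- \<tau> * real j) * 3" for j
    using corr[of j] by (simp only: m_def)
  hence "\<bar>m - m * m\<bar> \<le> 0"
    by (intro LIMSEQ_le_const[OF exp_decay_tendsto_0]) auto
  hence "m * (1 - m) = 0" by (simp add: algebra_simps)
  thus "prob {p} = 1" using m by (simp add: m_def)
qed

end

locale nonatomic_decay_system = decay_system +
  assumes nonatomic: "prob {p} = 0"
begin

lemma prob_cball_eq: "prob {y\<in>X. dist x y \<le> r} = prob (rball X x r)"
proof (rule measure_eq_AE)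
  have sing: "AE y in M. y \<noteq> p" for p
  proof (cases "p \<in> X")
    case True
    have "{p} \<in> null_sets M"
      using nonatomic[of p] singleton_sets[OF True] by (simp add: measure_eq_emeasure_eq_ennreal null_sets_def emeasure_eq_measure)
    thus ?thesis using AE_not_in by force
  next
    case False
    thus ?thesis by (intro AE_I2) (auto simp: space_M)
  qed
  show "AE y in M. (y \<in> {y\<in>X. dist x y \<le> r}) = (y \<in> rball X x r)"
    using sing[of "x - r"] sing[of "x + r"]
    by eventually_elim (auto simp: rball_def dist_real_def abs_if split: if_splits)
  have "{y\<in>X. dist x y \<le> r} = X \<inter> cball x r" by auto
  thus "{y\<in>X. dist x y \<le> r} \<in> sets M" using Int_borel_sets[of "cball x r"] by simp
qed auto

text \<open>Without atoms the distribution function is continuous, so the intermediate value theorem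
  applies to the mass of the ball as a function of its radius.\<close>

lemma rball_of_measure:
  assumes v: "0 < v" "v \<le> prob (rball X x r)"
  obtains \<rho> where "0 < \<rho>" "\<rho> \<le> r" "prob (rball X x \<rho>) = v"
proof -
  define N where "N = distr M borel (\<lambda>x. x)"
  have id_meas: "(\<lambda>x. x) \<in> M \<rightarrow>\<^sub>M borel"
    using Int_borel_sets by (intro measurableI) (auto simp: space_M Int_commute)
  interpret N: real_distribution N
    unfolding N_def using id_meas by (rule real_distribution_distr)
  have N_eq: "measure N A = prob (X \<inter> A)" if "A \<in> sets borel" for A
    using that id_meas by (simp add: N_def measure_distr space_M Int_commute)
  have pt: "measure N {y} = 0" for y
  proof (cases "y \<in> X")
    case True
    thus ?thesis using nonatomic[of y] by (simp add: N_eq Int_absorb1)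
  qed (auto simp: N_eq)
  \<comment> \<open>For positive radius this is the mass of a half-open interval, which differs from
    the ball by one null point; at radius 0 it vanishes.\<close>
  define F where "F \<rho> = cdf N (x + \<rho>) - cdf N (x - \<rho>)" for \<rho>
  have cont: "isCont (cdf N) y" for y using N.isCont_cdf pt by blast
  have F: "prob (rball X x \<rho>) = F \<rho>" if "\<rho> > 0" for \<rho>
  proof -
    have "rball X x \<rho> = X \<inter> {x - \<rho><..<x + \<rho>}" by (auto simp: rball_def dist_real_def)
    hence "prob (rball X x \<rho>) = measure N {x - \<rho><..<x + \<rho>}" by (simp add: N_eq)
    also have "\<dots> = measure N ({x - \<rho><..<x + \<rho>} \<union> {x + \<rho>})"
      using pt[of "x + \<rho>"] by (subst N.finite_measure_Union) auto
    also have "{x - \<rho><..<x + \<rho>} \<union> {x + \<rho>} = {x - \<rho><..x + \<rho>}" using that by auto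
    also have "measure N \<dots> = F \<rho>" using that unfolding F_def by (subst N.cdf_diff_eq) auto
    finally show ?thesis .
  qed
  have r: "r > 0"
  proof (rule ccontr)
    assume "\<not> r > 0"
    hence "rball X x r = {}" using zero_le_dist[of x] by (auto simp: rball_def) (meson less_le_trans not_less zero_le_dist)
    hence "prob (rball X x r) = 0" by (simp only: measure_empty)
    thus False using v by simp
  qed
  have "\<exists>\<rho>\<ge>0. \<rho> \<le> r \<and> F \<rho> = v"
  proof (rule IVT')
    show "F 0 \<le> v" "v \<le> F r" "0 \<le> r" using v r F[OF r] by (auto simp: F_def)
    have "isCont F \<rho>" for \<rho> unfolding F_def
      by (intro continuous_intros isCont_o2[OF _ cont])
    thus "continuous_on {0..r} F" by (simp add: continuous_at_imp_continuous_on)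
  qed
  then obtain \<rho> where \<rho>: "0 \<le> \<rho>" "\<rho> \<le> r" "F \<rho> = v" by blast
  moreover have "\<rho> \<noteq> 0" using \<rho>(3) v by (auto simp: F_def)
  ultimately show ?thesis using that[of \<rho>] F[of \<rho>] by auto
qed

end

section \<open>Eventual hitting\<close>

lemma summable_inverse_n_ln_powr:
  fixes a :: real
  assumes "a > 1"
  shows "summable (\<lambda>n. 1 / (real n * ln (real n) powr a))"
proof -
  \<comment> \<open>The shift keeps \<open>ln 1 = 0\<close> away from positive indices: with
    division by zero the unshifted term at 1 would be 0, and monotonicity from index 1 on, which
    condensation requires, would fail.\<close>
  define g where "g m = 1 / (real (Suc m) * ln (real (Suc m)) powr a)" for m
  have "summable (\<lambda>n. 2 ^ n * g (2 ^ n))"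
  proof (rule summable_comparison_test_ev)
    show "eventually (\<lambda>n. norm (2 ^ n * g (2 ^ n)) \<le> ln 2 powr (-a) * real n powr (-a)) sequentially"
      using eventually_gt_at_top[of 0]
    proof eventually_elim
      case (elim n)
      have "real n * ln 2 = ln (2 ^ n)" by (simp add: ln_realpow)
      also have "\<dots> \<le> ln (real (Suc (2 ^ n)))" by (subst ln_le_cancel_iff) (auto simp: add_pos_pos)
      finally have "(real n * ln 2) powr a \<le> ln (real (Suc (2 ^ n))) powr a"
        using assms by (intro powr_mono2) auto
      moreover have pos: "(real n * ln 2) powr a > 0" using elim by simp
      ultimately have "2 ^ n * (real n * ln 2) powr a \<le> real (Suc (2 ^ n)) * ln (real (Suc (2 ^ n))) powr a"
        by (intro mult_mono) (auto intro: add_nonneg_nonneg)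
      moreover have "2 ^ n * (real n * ln 2) powr a > 0" using pos by simp
      moreover have "real (Suc (2 ^ n)) * ln (real (Suc (2 ^ n))) powr a > 0"
        using calculation by linarith
      ultimately have "g (2 ^ n) \<le> 1 / (2 ^ n * (real n * ln 2) powr a)"
        unfolding g_def by (intro frac_le) (assumption | simp)+
      hence "2 ^ n * g (2 ^ n) \<le> 1 / (real n * ln 2) powr a"
        using pos by (simp add: field_simps)
      also have "\<dots> = ln 2 powr (-a) * real n powr (-a)"
        by (simp add: powr_mult powr_minus field_simps)
      finally show ?case by (simp add: g_def)
    qed
    show "summable (\<lambda>n. ln 2 powr (-a) * real n powr (-a))"
      using assms by (intro summable_mult) (simp add: summable_real_powr_iff)
  qed
  moreover have "summable g \<longleftrightarrow> summable (\<lambda>n. 2 ^ n * g (2 ^ n))"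
  proof (rule condensation_test)
    fix m :: nat assume m: "0 < m"
    have "real (Suc m) * ln (real (Suc m)) powr a \<le> real (Suc (Suc m)) * ln (real (Suc (Suc m))) powr a"
      using m assms by (intro mult_mono powr_mono2) auto
    thus "g (Suc m) \<le> g m" unfolding g_def using m
      by (intro divide_left_mono mult_pos_pos) auto
  qed (auto simp: g_def)
  ultimately have "summable g" by blast
  thus ?thesis unfolding g_def by (subst (asm) summable_Suc_iff)
qed

text \<open>The integral of the weighted count is the given convergent series, so the count is
  finite almost everywhere. With weights \<open>1 / n\<close> it measures runs of indices on a
  logarithmic scale.\<close>

lemma (in finite_measure) AE_summable_indicator:
  fixes c :: "nat \<Rightarrow> real"
  assumes V: "\<And>n. V n \<in> sets M" and c: "\<And>n. c n \<ge> 0"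
    and summ: "summable (\<lambda>n. c n * measure M (V n))"
  shows "AE x in M. summable (\<lambda>n. c n * indicator (V n) x)"
proof -
  note [measurable] = V
  have "(\<integral>\<^sup>+x. (\<Sum>n. ennreal (c n * indicator (V n) x)) \<partial>M) =
      (\<Sum>n. \<integral>\<^sup>+x. ennreal (c n * indicator (V n) x) \<partial>M)"
    by (rule nn_integral_suminf) auto
  also have "\<dots> = (\<Sum>n. ennreal (c n * measure M (V n)))"
  proof (intro suminf_cong)
    fix n
    have "(\<integral>\<^sup>+x. ennreal (c n * indicator (V n) x) \<partial>M) = (\<integral>\<^sup>+x. ennreal (c n) * indicator (V n) x \<partial>M)"
      using c by (intro nn_integral_cong) (auto simp: indicator_def)
    also have "\<dots> = ennreal (c n * measure M (V n))"
      using c V by (simp add: nn_integral_cmult emeasure_eq_measure ennreal_mult)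
    finally show "(\<integral>\<^sup>+x. ennreal (c n * indicator (V n) x) \<partial>M) = ennreal (c n * measure M (V n))" .
  qed
  also have "\<dots> = ennreal (\<Sum>n. c n * measure M (V n))"
    using c summ by (intro suminf_ennreal2) auto
  finally have "(\<integral>\<^sup>+x. (\<Sum>n. ennreal (c n * indicator (V n) x)) \<partial>M) \<noteq> \<infinity>" by simp
  hence "AE x in M. (\<Sum>n. ennreal (c n * indicator (V n) x)) \<noteq> \<infinity>"
    by (intro nn_integral_PInf_AE) auto
  thus ?thesis
  proof eventually_elim
    case (elim x)
    thus ?case using c by (intro summable_suminf_not_top) (auto simp: infinity_ennreal_def)
  qed
qed

context decay_system begin

lemma rball_mono: "r \<le> r' \<Longrightarrow> rball X x r \<subseteq> rball X x r'"
  by (auto simp: rball_def)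

text \<open>If the ball of radius \<open>r m\<close> is missed for \<open>a * m\<close> steps, then the smaller balls of radius
  \<open>\<rho> n\<close> are missed for \<open>\<beta> * n\<close> steps for all \<open>n\<close> between \<open>m\<close> and \<open>a * m / \<beta>\<close>. Such a run of indices
  has logarithmic mass bounded below, so a logarithmically weighted Borel--Cantelli argument
  needs no thinning of the sequence.\<close>

lemma AE_eventually_hit:
  assumes summ: "summable (\<lambda>n. 1 / real n * prob (no_hit (rball X x0 (\<rho> n)) (nat \<lceil>\<beta> * real n\<rceil>)))"
    and \<beta>: "0 < \<beta>" "\<beta> < a"
    and \<rho>: "\<And>n. n \<ge> 1 \<Longrightarrow> \<rho> n \<le> r n" and r: "antimono_on {1..} r"
  shows "AE x in M. eventually (\<lambda>n. x \<notin> no_hit (rball X x0 (r n)) (nat \<lceil>a * real n\<rceil>)) sequentially"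
proof -
  define V where "V n = no_hit (rball X x0 (\<rho> n)) (nat \<lceil>\<beta> * real n\<rceil>)" for n
  have "AE x in M. summable (\<lambda>n. 1 / real n * indicator (V n) x)"
    using summ by (intro AE_summable_indicator) (auto simp: V_def)
  thus ?thesis
  proof eventually_elim
    case (elim x)
    define L where "L = a / \<beta>"
    have L: "L > 1" using \<beta> by (simp add: L_def)
    \<comment> \<open>By the Cauchy criterion late runs have mass below \<open>(L - 1) / L\<close>,
      which is precisely the lower bound found below for a run from \<open>m\<close> to
      \<open>L * m\<close>.\<close>
    obtain N where N: "\<And>m n. m \<ge> N \<Longrightarrow> norm (\<Sum>k=m..n. 1 / real k * indicator (V k) x) < (L - 1) / L"
      using summable_partial_sum_bound[OF elim, of "(L - 1) / L"] L by auto
    have "x \<notin> no_hit (rball X x0 (r m)) (nat \<lceil>a * real m\<rceil>)" if m: "m \<ge> max N 1" for m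
    proof
      assume x: "x \<in> no_hit (rball X x0 (r m)) (nat \<lceil>a * real m\<rceil>)"
      define n where "n = nat \<lfloor>L * real m\<rfloor>"
      have Lm: "real m \<le> L * real m" using L mult_right_mono[of 1 L "real m"] by simp
      have n: "real n \<le> L * real m" "L * real m < real n + 1"
        unfolding n_def using L by (auto simp: of_nat_nat)
      have V: "x \<in> V k" if k: "k \<in> {m..n}" for k
      proof -
        have "\<rho> k \<le> r m" using \<rho>[of k] monotone_onD[OF r, of m k] k m by auto
        moreover have "\<beta> * real k \<le> a * real m"
        proof -
          have "\<beta> * real k \<le> \<beta> * (L * real m)" using k n(1) \<beta> by (intro mult_left_mono) auto
          thus ?thesis using \<beta> by (simp add: L_def)
        qed
        hence "nat \<lceil>\<beta> * real k\<rceil> \<le> nat \<lceil>a * real m\<rceil>" by (intro nat_mono ceiling_mono)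
        ultimately show ?thesis
          using x no_hit_mono[OF rball_mono] unfolding V_def by blast
      qed
      have mn: "m \<le> n" using Lm m unfolding n_def by (simp add: le_nat_floor)
      \<comment> \<open>The run has more than \<open>(L - 1) * m\<close> indices, each of weight at
        least \<open>1 / (L * m)\<close>.\<close>
      have "(L - 1) / L = (L * real m - real m) * (1 / (L * real m))"
        using m L by (simp add: field_simps)
      also have "\<dots> \<le> real (card {m..n}) * (1 / (L * real m))"
        using n(2) L mn by (intro mult_right_mono) auto
      also have "\<dots> = (\<Sum>k=m..n. 1 / (L * real m))" by simp
      also have "\<dots> \<le> (\<Sum>k=m..n. 1 / real k * indicator (V k) x)"
      proof (intro sum_mono)
        fix k assume k: "k \<in> {m..n}"
        hence "1 / (L * real m) \<le> 1 / real k" using m n(1) L by (intro divide_left_mono mult_pos_pos) auto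
        thus "1 / (L * real m) \<le> 1 / real k * indicator (V k) x" using V[OF k] by simp
      qed
      finally show False using N[of m n] m by auto
    qed
    thus ?case unfolding eventually_sequentially by blast
  qed
qed

text \<open>At most about \<open>\<beta> * n / t\<close> blocks each contribute an error of order
  \<open>t * n^(-1-\<gamma>)\<close>, in total \<open>n^-\<gamma>\<close>, which is summable against
  \<open>1 / n\<close>. The condition \<open>s < \<sigma>\<close> bounds the expected number of hits
  in a block by 1, as the recursion demands.\<close>

lemma no_hit_prob_bound:
  fixes \<rho> :: "nat \<Rightarrow> real" and s \<gamma> \<sigma> \<beta> \<kappa> x0 :: real
  defines "B \<equiv> \<lambda>n. rball X x0 (\<rho> n)"
  assumes s: "0 < s" "s < 1" "s < \<sigma>" and \<gamma>: "0 < \<gamma>" and \<beta>: "0 < \<beta>" and \<kappa>: "0 < \<kappa>" "\<kappa> < 1"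
    and returns: "(\<lambda>n. \<Sum>j \<in> {j::nat. 1 \<le> j \<and> real j \<le> real n powr s}.
          prob (B n \<inter> preimage_iter X f j (B n))) \<in> O(\<lambda>n. real n powr (- 1 - \<gamma>))"
    and small: "\<And>n. n \<ge> 1 \<Longrightarrow> prob (B n) \<le> real n powr (- \<sigma>)"
  shows "\<exists>c. eventually (\<lambda>n. prob (no_hit (B n) (nat \<lceil>\<beta> * real n\<rceil>)) \<le>
    exp (- \<kappa> * \<beta> * real n * prob (B n)) + c * real n powr (- \<gamma>)) sequentially"
proof -
  \<comment> \<open>The block length is the range of lags covered by \<open>returns\<close>. Its
    square root is negligible against it, yet as a gap it makes the correlation error smaller than
    any power of \<open>n\<close>.\<close>
  define t g where "t n = nat \<lfloor>real n powr s\<rfloor>" and "g n = nat \<lfloor>real n powr (s/2)\<rfloor>" for n :: nat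
  define S where "S n = (\<Sum>j=1..t n. prob (B n \<inter> preimage_iter X f j (B n)))" for n
  have "{j::nat. 1 \<le> j \<and> real j \<le> real n powr s} = {1..t n}" for n
    by (auto simp: t_def le_nat_floor le_floor_iff nat_le_iff le_nat_iff)
  hence "S \<in> O(\<lambda>n. real n powr (- 1 - \<gamma>))"
    using returns by (simp add: S_def[abs_def])
  then obtain c where c: "c > 0" "eventually (\<lambda>n. norm (S n) \<le> c * norm (real n powr (- 1 - \<gamma>))) sequentially"
    by (elim landau_o.bigE)
  \<comment> \<open>The gaps cost a vanishing fraction of the time and rounding costs one block;
    \<open>\<kappa> < 1\<close> pays for both.\<close>
  have ev1: "eventually (\<lambda>n. \<beta> * real n * (real (t n) / (real (t n) + real (g n))) - real (t n) \<ge> \<kappa> * \<beta> * real n) sequentially"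
    unfolding t_def g_def using s \<beta> \<kappa> by real_asymp
  have ev2: "eventually (\<lambda>n. (\<beta> * real n + 1) * (3 * C * exp (- \<tau> * real (g n))) \<le> real n powr (- \<gamma>)) sequentially"
    unfolding g_def using s \<beta> \<tau>_pos C_pos \<gamma> by real_asymp
  have "eventually (\<lambda>n. prob (no_hit (B n) (nat \<lceil>\<beta> * real n\<rceil>)) \<le>
    exp (- \<kappa> * \<beta> * real n * prob (B n)) + (1 + (\<beta> + 1) * c) * real n powr (- \<gamma>)) sequentially"
    using c(2) ev1 ev2 eventually_ge_at_top[of 1]
  proof eventually_elim
    case (elim n)
    define N q p where "N = nat \<lceil>\<beta> * real n\<rceil>" and "q = N div (t n + g n)" and "p = prob (B n)"
    have N: "real N \<ge> \<beta> * real n" "real N \<le> \<beta> * real n + 1"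
      unfolding N_def using \<beta> by (auto simp: of_nat_nat)
    have t: "real (t n) \<le> real n powr s" "t n \<ge> 1"
      using s \<open>1 \<le> n\<close> by (auto simp: t_def of_nat_nat le_nat_floor ge_one_powr_ge_zero)
    have p: "0 \<le> p" "p \<le> real n powr (-\<sigma>)" using small[of n] \<open>1 \<le> n\<close> by (auto simp: p_def)
    have "real (t n) * p \<le> real n powr s * real n powr (-\<sigma>)"
      using t p by (intro mult_mono) auto
    also have "\<dots> = real n powr (s - \<sigma>)" by (simp add: powr_add[symmetric])
    also have "\<dots> \<le> real n powr 0" using s \<open>1 \<le> n\<close> by (intro powr_mono) auto
    also have "\<dots> = 1" using \<open>1 \<le> n\<close> by simp
    finally have tp: "real (t n) * p \<le> 1" .
    have q1: "real q * (real (t n) + real (g n)) \<le> real N"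
      unfolding q_def by (metis div_times_less_eq_dividend of_nat_add of_nat_mono of_nat_mult)
    have qt: "real q * real (t n) \<le> \<beta> * real n + 1"
    proof -
      have "real q * real (t n) \<le> real q * (real (t n) + real (g n))" by (intro mult_left_mono) auto
      thus ?thesis using q1 N by linarith
    qed
    have q2: "real q * real (t n) \<ge> \<kappa> * \<beta> * real n"
    proof -
      have "real N / (real (t n) + real (g n)) \<le> real q + 1"
      proof -
        have "N < (q + 1) * (t n + g n)"
          unfolding q_def using t dividend_less_div_times[of "t n + g n" N] by (simp add: algebra_simps)
        hence "real N \<le> (real q + 1) * (real (t n) + real (g n))"
          by (metis less_imp_le of_nat_1 of_nat_add of_nat_mono of_nat_mult)
        thus ?thesis using t by (simp add: field_simps)
      qed
      hence "\<beta> * real n / (real (t n) + real (g n)) - 1 \<le> real q"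
        using N t divide_right_mono[OF N(1), of "real (t n) + real (g n)"] by linarith
      hence "(\<beta> * real n / (real (t n) + real (g n)) - 1) * real (t n) \<le> real q * real (t n)"
        by (intro mult_right_mono) auto
      thus ?thesis using elim(2) by (simp add: algebra_simps)
    qed
    have "S n \<ge> 0" unfolding S_def by (intro sum_nonneg) auto
    hence Sn: "0 \<le> S n" "S n \<le> c * real n powr (-1 - \<gamma>)" using elim(1) by auto
    have "prob (no_hit (B n) N) \<le> prob (no_hit (B n) (q * (t n + g n)))"
      by (intro finite_measure_mono no_hit_mono) (auto simp: q_def B_def)
    also have "\<dots> \<le> (1 - real (t n) * p) ^ q + real q * (real (t n) * (3 * C * exp (- \<tau> * real (g n)) + S n))"
      using no_hit_upper[of "B n" "t n" q "g n"] tp pieces_rball[OF interval_X]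
      by (simp add: p_def S_def B_def)
    also have "(1 - real (t n) * p) ^ q \<le> exp (- (real (t n) * p)) ^ q"
      using tp exp_ge_add_one_self[of "- (real (t n) * p)"] by (intro power_mono) auto
    also have "\<dots> = exp (- (real q * real (t n) * p))"
      by (simp add: exp_of_nat_mult[symmetric] mult.assoc)
    also have "\<dots> \<le> exp (- \<kappa> * \<beta> * real n * p)"
      using mult_right_mono[OF q2 p(1)] by simp
    also have "real q * (real (t n) * (3 * C * exp (- \<tau> * real (g n)) + S n)) =
        (real q * real (t n)) * (3 * C * exp (- \<tau> * real (g n)) + S n)" by simp
    also have "\<dots> \<le> (\<beta> * real n + 1) * (3 * C * exp (- \<tau> * real (g n)) + c * real n powr (-1 - \<gamma>))"
      using qt Sn C_pos \<beta> by (intro mult_mono add_left_mono) auto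
    also have "\<dots> \<le> real n powr (- \<gamma>) + (\<beta> * real n + 1) * (c * real n powr (-1 - \<gamma>))"
      using elim(3) by (simp add: ring_distribs)
    also have "(\<beta> * real n + 1) * (c * real n powr (-1 - \<gamma>)) \<le> ((\<beta> + 1) * real n) * (c * real n powr (-1 - \<gamma>))"
      using \<open>1 \<le> n\<close> c by (intro mult_right_mono) (auto simp: algebra_simps)
    also have "\<dots> = (\<beta> + 1) * c * (real n powr 1 * real n powr (-1 - \<gamma>))" using \<open>1 \<le> n\<close> by simp
    also have "real n powr 1 * real n powr (-1 - \<gamma>) = real n powr (- \<gamma>)"
      unfolding powr_add[symmetric] by simp
    finally show ?case by (simp add: N_def p_def algebra_simps)
  qed
  thus ?thesis by blast
qed

end

section \<open>From convergent series to eventual hitting\<close>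

lemma summable_exp_powr_over_n:
  fixes b d :: real
  assumes "b > 0" "d > 0"
  shows "summable (\<lambda>n. exp (- b * real n powr d) / real n)"
proof (rule summable_comparison_test_ev)
  show "eventually (\<lambda>n. norm (exp (- b * real n powr d) / real n) \<le> real n powr (-2)) sequentially"
  proof -
    have "eventually (\<lambda>n. exp (- b * real n powr d) / real n \<le> real n powr (-2)) sequentially"
      using assms by real_asymp
    thus ?thesis by eventually_elim simp
  qed
qed (simp add: summable_real_powr_iff)

context nonatomic_decay_system begin

text \<open>The masses are cut down to \<open>q n\<close>, the minimum of \<open>p n\<close> and
  \<open>n^-\<sigma>\<close>, so that the return time hypothesis applies. Its requirement of a
  divergent sum holds because monotonicity of \<open>n * p n\<close> gives \<open>q n\<close> at
  least a constant over \<open>n\<close>. The smaller balls lie inside the given ones, so hitting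
  them suffices.\<close>

lemma AE_eventually_hit_of_summable:
  fixes r :: "nat \<Rightarrow> real" and x0 a \<beta> \<kappa> :: real
  defines "p \<equiv> \<lambda>n. prob (rball X x0 (r n))"
  assumes A2: "short_return_times M f x0"
    and r: "antimono_on {1..} r"
    and p_pos: "p 1 > 0" and mono: "mono_on {1..} (\<lambda>n. real n * p n)"
    and \<beta>: "0 < \<beta>" "\<beta> < a" and \<kappa>: "0 < \<kappa>" "\<kappa> < 1"
    and summ: "summable (\<lambda>n. exp (- \<kappa> * \<beta> * real n * p n) / real n)"
  shows "AE x in M. eventually (\<lambda>n. x \<notin> no_hit (rball X x0 (r n)) (nat \<lceil>a * real n\<rceil>)) sequentially"
proof -
  obtain s \<gamma> \<sigma> :: real where s: "s \<in> {0<..<1}" and \<gamma>: "\<gamma> \<in> {0<..<1}" and \<sigma>: "\<sigma> \<in> {0<..<1}"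
    and \<sigma>': "\<sigma> > Max {(1 + \<gamma> + s) / 2, 1 - \<gamma>, (2 + s) / 3, 1 - s / 2}"
    and A2: "\<forall>\<rho> :: nat \<Rightarrow> real. (\<forall>n. \<rho> n > 0) \<longrightarrow>
           \<not> summable (\<lambda>n. measure M (rball X x0 (\<rho> n))) \<longrightarrow>
           (\<lambda>n. measure M (rball X x0 (\<rho> n))) \<in> O(\<lambda>n. real n powr (- \<sigma>)) \<longrightarrow>
           (\<lambda>n. \<Sum>j \<in> {j::nat. 1 \<le> j \<and> real j \<le> real n powr s}.
                  measure M (rball X x0 (\<rho> n) \<inter> preimage_iter X f j (rball X x0 (\<rho> n))))
             \<in> O(\<lambda>n. real n powr (- 1 - \<gamma>))"
    using A2 unfolding short_return_times_def space_M by (elim exE conjE) (rule that)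
  have s\<sigma>: "s < \<sigma>" using \<sigma>' s by simp
  have np: "p 1 \<le> real n * p n" if "n \<ge> 1" for n
    using mono_onD[OF mono, of 1 n] that by simp
  define q where "q n = min (p n) (real n powr (- \<sigma>))" for n
  have q_lower: "min (p 1) 1 / real n \<le> q n" if n: "n \<ge> 1" for n
  proof -
    have "min (p 1) 1 / real n \<le> p n" using np[OF n] n by (simp add: field_simps min_le_iff_disj)
    moreover have "1 / real n \<le> real n powr (- \<sigma>)"
      using powr_mono[of "-1" "- \<sigma>" "real n"] \<sigma> n by (simp add: powr_minus inverse_eq_divide)
    hence "min (p 1) 1 / real n \<le> real n powr (- \<sigma>)"
      using divide_right_mono[of "min (p 1) 1" 1 "real n"] by linarith
    ultimately show ?thesis by (simp add: q_def)
  qed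
  have q_pos: "q n > 0" if "n \<ge> 1" for n
  proof -
    have "0 < min (p 1) 1 / real n" using that p_pos by (intro divide_pos_pos) auto
    thus ?thesis using q_lower[OF that] by linarith
  qed
  have "\<exists>\<rho>. 0 < \<rho> \<and> \<rho> \<le> r n \<and> prob (rball X x0 \<rho>) = q n" if "n \<ge> 1" for n
    using rball_of_measure[of "q n" x0 "r n"] q_pos[OF that] by (auto simp: q_def p_def)
  then obtain \<rho>' where \<rho>': "\<And>n. n \<ge> 1 \<Longrightarrow> 0 < \<rho>' n \<and> \<rho>' n \<le> r n \<and> prob (rball X x0 (\<rho>' n)) = q n"
    by metis
  \<comment> \<open>The hypothesis wants positive radii at every index, including 0; any positive
    value there will do.\<close>
  define \<rho> where "\<rho> n = (if n = 0 then 1 else \<rho>' n)" for n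
  have \<rho>: "0 < \<rho> n" for n using \<rho>' by (auto simp: \<rho>_def)
  have \<rho>r: "\<rho> n \<le> r n" if "n \<ge> 1" for n using \<rho>' that by (auto simp: \<rho>_def)
  have prob_\<rho>: "prob (rball X x0 (\<rho> n)) = q n" if "n \<ge> 1" for n using \<rho>' that by (auto simp: \<rho>_def)
  have "\<not> summable (\<lambda>n. prob (rball X x0 (\<rho> n)))"
  proof
    assume *: "summable (\<lambda>n. prob (rball X x0 (\<rho> n)))"
    have "summable (\<lambda>n. min (p 1) 1 / real n)"
      by (rule summable_comparison_test'[OF *, of 1]) (use q_lower prob_\<rho> p_pos in auto)
    hence "summable (\<lambda>n. (1 / min (p 1) 1) * (min (p 1) 1 / real n))" by (rule summable_mult)
    moreover have "min (p 1) 1 \<noteq> 0" using p_pos by linarith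
    ultimately have "summable (\<lambda>n. inverse (real n))" by (simp add: inverse_eq_divide)
    thus False using not_summable_harmonic[where 'a = real] by simp
  qed
  moreover have "(\<lambda>n. prob (rball X x0 (\<rho> n))) \<in> O(\<lambda>n. real n powr (- \<sigma>))"
    by (rule bigoI[of _ 1], rule eventually_mono[OF eventually_ge_at_top[of 1]])
       (use q_pos in \<open>simp add: prob_\<rho> abs_of_pos\<close>, simp add: q_def)
  ultimately have returns: "(\<lambda>n. \<Sum>j \<in> {j::nat. 1 \<le> j \<and> real j \<le> real n powr s}.
      prob (rball X x0 (\<rho> n) \<inter> preimage_iter X f j (rball X x0 (\<rho> n)))) \<in> O(\<lambda>n. real n powr (- 1 - \<gamma>))"
    using A2 \<rho> by blast
  define V where "V n = no_hit (rball X x0 (\<rho> n)) (nat \<lceil>\<beta> * real n\<rceil>)" for n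
  obtain c where c: "eventually (\<lambda>n. prob (V n) \<le>
      exp (- \<kappa> * \<beta> * real n * prob (rball X x0 (\<rho> n))) + c * real n powr (- \<gamma>)) sequentially"
    unfolding V_def
    using no_hit_prob_bound[OF _ _ s\<sigma> _ \<beta>(1) \<kappa> returns] s \<gamma> prob_\<rho> by (auto simp: q_def)
  have "summable (\<lambda>n. 1 / real n * prob (V n))"
  proof (rule summable_comparison_test_ev)
    show "eventually (\<lambda>n. norm (1 / real n * prob (V n)) \<le>
        exp (- \<kappa> * \<beta> * real n * p n) / real n + exp (- (\<kappa> * \<beta>) * real n powr (1 - \<sigma>)) / real n
          + c * real n powr (- 1 - \<gamma>)) sequentially"
      using c eventually_ge_at_top[of 1]
    proof eventually_elim
      case (elim n)
      \<comment> \<open>The exponential at the minimum is one of the two exponentials, hence at most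
        their sum. The one caused by the cut is summable against \<open>1 / n\<close> because
        \<open>\<sigma> < 1\<close>.\<close>
      have "exp (- \<kappa> * \<beta> * real n * q n) \<le> exp (- \<kappa> * \<beta> * real n * p n) + exp (- (\<kappa> * \<beta>) * real n powr (1 - \<sigma>))"
      proof (cases "p n \<le> real n powr (- \<sigma>)")
        case True
        thus ?thesis by (simp add: q_def)
      next
        case False
        have "real n * real n powr (- \<sigma>) = real n powr (1 - \<sigma>)"
          using elim by (simp add: powr_diff powr_minus field_simps)
        thus ?thesis using False by (simp add: q_def mult.assoc)
      qed
      hence "prob (V n) \<le> exp (- \<kappa> * \<beta> * real n * p n) + exp (- (\<kappa> * \<beta>) * real n powr (1 - \<sigma>)) + c * real n powr (- \<gamma>)"
        using elim prob_\<rho> by simp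
      hence "prob (V n) / real n \<le> (exp (- \<kappa> * \<beta> * real n * p n) + exp (- (\<kappa> * \<beta>) * real n powr (1 - \<sigma>)) + c * real n powr (- \<gamma>)) / real n"
        by (intro divide_right_mono) auto
      moreover have "real n powr (- 1 - \<gamma>) = real n powr (- \<gamma>) / real n"
        using elim powr_add[of "real n" "-1" "-\<gamma>"] by (simp add: powr_minus field_simps)
      ultimately show ?case by (simp add: add_divide_distrib)
    qed
    show "summable (\<lambda>n. exp (- \<kappa> * \<beta> * real n * p n) / real n + exp (- (\<kappa> * \<beta>) * real n powr (1 - \<sigma>)) / real n
          + c * real n powr (- 1 - \<gamma>))"
      using \<beta> \<kappa> \<sigma> \<gamma> by (intro summable_add summ summable_mult summable_exp_powr_over_n)
        (auto simp: summable_real_powr_iff)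
  qed
  thus ?thesis
    using AE_eventually_hit[OF _ \<beta> _ r, of x0 \<rho>] \<rho>r by (simp add: V_def)
qed

text \<open>Where \<open>n * p n \<ge> 1\<close>, replacing \<open>p n\<close> by the smaller
  \<open>1 / n\<close> yields the logarithmically weighted series. One such index exists, since
  otherwise the terms would dominate a multiple of \<open>1 / n\<close>, and by monotonicity all
  later indices follow.\<close>

lemma AE_eventually_hit_of_series:
  fixes r :: "nat \<Rightarrow> real" and x0 a :: real
  defines "p \<equiv> \<lambda>n. prob (rball X x0 (r n))"
  assumes A2: "short_return_times M f x0"
    and r: "antimono_on {1..} r"
    and p_pos: "p 1 > 0" and mono: "mono_on {1..} (\<lambda>n. real n * p n)"
    and summ: "summable (\<lambda>n. p n * exp (- real n * p n))"
    and a: "a > 1"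
  shows "AE x in M. eventually (\<lambda>n. x \<notin> no_hit (rball X x0 (r n)) (nat \<lceil>a * real n\<rceil>)) sequentially"
proof -
  \<comment> \<open>With \<open>\<beta>\<close> strictly between 1 and \<open>a\<close>, the choice
    \<open>\<kappa> = 1 / \<beta>\<close> is below 1 and restores the exponent
    \<open>n * p n\<close> of the given series.\<close>
  define \<beta> where "\<beta> = (1 + a) / 2"
  have \<beta>: "1 < \<beta>" "\<beta> < a" using a by (auto simp: \<beta>_def)
  have "\<exists>n\<ge>1. real n * p n \<ge> 1"
  proof (rule ccontr)
    assume "\<not> ?thesis"
    hence small: "real n * p n < 1" if "n \<ge> 1" for n using that by force
    have "summable (\<lambda>n. p 1 * exp (-1) / real n)"
    proof (rule summable_comparison_test'[OF summ, of 1])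
      fix n :: nat assume n: "n \<ge> 1"
      have "p 1 \<le> real n * p n" using mono_onD[OF mono, of 1 n] n by simp
      hence "p 1 / real n \<le> p n" using n by (simp add: field_simps)
      moreover have "exp (-1) \<le> exp (- real n * p n)" using small[OF n] by simp
      ultimately have "p 1 / real n * exp (-1) \<le> p n * exp (- real n * p n)"
        using p_pos by (intro mult_mono) (auto simp: p_def)
      thus "norm (p 1 * exp (-1) / real n) \<le> p n * exp (- real n * p n)" using p_pos by simp
    qed
    hence "summable (\<lambda>n. (1 / (p 1 * exp (-1))) * (p 1 * exp (-1) / real n))" by (rule summable_mult)
    hence "summable (\<lambda>n. inverse (real n))" using p_pos by (simp add: field_simps)
    thus False using not_summable_harmonic[where 'a = real] by simp
  qed
  then obtain N where N: "N \<ge> 1" "real N * p N \<ge> 1" by blast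
  have "summable (\<lambda>n. exp (- (1 / \<beta>) * \<beta> * real n * p n) / real n)"
  proof (rule summable_comparison_test'[OF summ, of N])
    fix n :: nat assume n: "n \<ge> N"
    have "real n * p n \<ge> 1" using mono_onD[OF mono, of N n] n N by simp
    hence "1 / real n \<le> p n" using n N by (simp add: field_simps)
    hence "1 / real n * exp (- real n * p n) \<le> p n * exp (- real n * p n)"
      by (intro mult_right_mono) auto
    thus "norm (exp (- (1 / \<beta>) * \<beta> * real n * p n) / real n) \<le> p n * exp (- real n * p n)"
      using \<beta> by simp
  qed
  thus ?thesis
    using AE_eventually_hit_of_summable[of x0 r \<beta> a "1 / \<beta>"] A2 r p_pos mono \<beta> by (simp add: p_def)
qed

lemma AE_eventually_hit_of_loglog:
  fixes r :: "nat \<Rightarrow> real" and x0 c :: real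
  defines "p \<equiv> \<lambda>n. prob (rball X x0 (r n))"
  assumes A2: "short_return_times M f x0"
    and r: "antimono_on {1..} r"
    and p_pos: "p 1 > 0" and mono: "mono_on {1..} (\<lambda>n. real n * p n)"
    and c: "c > 1" and lower: "eventually (\<lambda>n. p n \<ge> c * (ln (ln (real n)) / real n)) sequentially"
  shows "AE x in M. eventually (\<lambda>n. x \<notin> no_hit (rball X x0 (r n)) n) sequentially"
proof -
  \<comment> \<open>Here \<open>a = 1\<close>, so the room has to come from \<open>c\<close>. With
    \<open>\<kappa> = \<beta> = c^(-1/3)\<close> the logarithm gets the exponent
    \<open>\<beta> * \<beta> * c = c^(1/3) > 1\<close>.\<close>
  define \<beta> where "\<beta> = (1 / c) powr (1/3)"
  have \<beta>: "0 < \<beta>" "\<beta> < 1" using c powr_less_mono2[of "1/3" "1/c" 1] by (auto simp: \<beta>_def)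
  have "\<beta> * \<beta> * c = c powr (1/3)"
    using c by (simp add: \<beta>_def powr_add[symmetric] powr_divide) (simp add: powr_mult_base powr_diff field_simps powr_add[symmetric])
  hence c': "\<beta> * \<beta> * c > 1" using c by simp
  have "summable (\<lambda>n. exp (- \<beta> * \<beta> * real n * p n) / real n)"
  proof (rule summable_comparison_test_ev)
    have "eventually (\<lambda>n::nat. ln (real n) > 0 \<and> real n > 0) sequentially"
      by (intro eventually_conj; real_asymp)
    thus "eventually (\<lambda>n. norm (exp (- \<beta> * \<beta> * real n * p n) / real n) \<le>
        1 / (real n * ln (real n) powr (\<beta> * \<beta> * c))) sequentially"
      using lower
    proof eventually_elim
      case (elim n)
      have "c * ln (ln (real n)) \<le> real n * p n" using elim by (simp add: field_simps)
      hence "\<beta> * \<beta> * (c * ln (ln (real n))) \<le> \<beta> * \<beta> * (real n * p n)"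
        using \<beta> by (intro mult_left_mono) auto
      hence "exp (- \<beta> * \<beta> * real n * p n) \<le> exp (- (\<beta> * \<beta> * c) * ln (ln (real n)))"
        by (simp add: mult_ac)
      also have "\<dots> = 1 / ln (real n) powr (\<beta> * \<beta> * c)"
        using elim by (auto simp: powr_def exp_minus inverse_eq_divide)
      finally have "exp (- \<beta> * \<beta> * real n * p n) / real n \<le> 1 / ln (real n) powr (\<beta> * \<beta> * c) / real n"
        by (intro divide_right_mono) auto
      thus ?case by (simp add: mult_ac)
    qed
  qed (rule summable_inverse_n_ln_powr[OF c'])
  thus ?thesis
    using AE_eventually_hit_of_summable[of x0 r \<beta> 1 \<beta>] A2 r p_pos mono \<beta> by (simp add: p_def)
qed

end

section \<open>Failure to hit at infinitely many scales\<close>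

context decay_system begin

text \<open>As \<open>m\<close> is at least the square root of \<open>n\<close>, the mass of a block
  \<open>t * p\<close> tends to 0 uniformly, and the product over blocks is close to
  \<open>exp (- m * p)\<close>, which is at least \<open>(ln n)^-\<theta>\<close>. The slack up to
  \<open>\<theta>'\<close> absorbs the quadratic term and the rounding, the factor 1/2 the additive
  errors. Uniformity in \<open>B\<close> and \<open>m\<close> is needed because many scales are
  compared at a single \<open>n\<close>.\<close>

lemma no_hit_lower_loglog:
  fixes \<theta> \<theta>' :: real
  assumes \<theta>: "0 < \<theta>" "\<theta> < \<theta>'"
  shows "eventually (\<lambda>n::nat. \<forall>B m. pieces X 1 B \<longrightarrow> B \<in> sets M \<longrightarrow> sqrt (real n) \<le> real m \<longrightarrow> m \<le> n \<longrightarrow>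
    real m * prob B \<le> \<theta> * ln (ln (real n)) \<longrightarrow> prob (no_hit B m) \<ge> 1/2 * ln (real n) powr (- \<theta>')) sequentially"
proof -
  \<comment> \<open>Blocks are short against the square root of \<open>n\<close>, hence against
    every admissible \<open>m\<close>. Gaps are shorter by a further power of \<open>n\<close>, so
    their cost is below any negative power of \<open>ln n\<close>.\<close>
  define t g where "t n = nat \<lfloor>real n powr (1/4)\<rfloor>" and "g n = nat \<lfloor>real n powr (1/8)\<rfloor>" for n :: nat
  define w where "w n = \<theta> * ln (ln (real n))" for n :: nat
  have e1: "eventually (\<lambda>n. real (t n) * w n / sqrt (real n) \<le> 1/2) sequentially"
    unfolding t_def w_def using \<theta> by real_asymp
  have e2: "eventually (\<lambda>n. (1 + 2 * (real (t n) * w n / sqrt (real n))) * (1 + real (t n) / sqrt (real n)) * \<theta> \<le> \<theta>') sequentially"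
    unfolding t_def w_def using \<theta> by real_asymp
  have e3: "eventually (\<lambda>n. 6 * real n * C * exp (- \<tau> * real (g n)) + 2 * real (g n) * w n / real (t n) \<le> 1/2 * ln (real n) powr (- \<theta>')) sequentially"
    unfolding t_def w_def g_def using \<theta> \<tau>_pos C_pos by real_asymp
  have e4: "eventually (\<lambda>n. 1 \<le> real (t n)) sequentially" "eventually (\<lambda>n. real (t n) \<le> sqrt (real n)) sequentially"
    unfolding t_def by real_asymp+
  have e5: "eventually (\<lambda>n::nat. ln (ln (real n)) > 0) sequentially" "eventually (\<lambda>n::nat. ln (real n) > 0) sequentially"
    by real_asymp+
  show ?thesis
    using e1 e2 e3 e4 e5 eventually_gt_at_top[of 0]
  proof eventually_elim
    case (elim n)
    show ?case
    proof (intro allI impI)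
      fix B m
      assume B: "pieces X 1 B" "B \<in> sets M" and m: "sqrt (real n) \<le> real m" "m \<le> n"
        and mp: "real m * prob B \<le> \<theta> * ln (ln (real n))"
      define p where "p = prob B"
      have p: "0 \<le> p" by (simp add: p_def)
      have mp: "real m * p \<le> w n" using mp by (simp add: p_def w_def)
      have w: "0 \<le> w n" using \<theta> elim by (simp add: w_def)
      have sq: "sqrt (real n) > 0" using elim by simp
      have t: "1 \<le> real (t n)" "real (t n) \<le> sqrt (real n)" using elim by auto
      \<comment> \<open>Rounded up, since a lower bound passes only from a longer miss to a shorter
        one.\<close>
      define q where "q = m div (t n + g n) + 1"
      have "m < q * (t n + g n)"
        unfolding q_def using t dividend_less_div_times[of "t n + g n" m] by (simp add: algebra_simps)
      hence mq: "m \<le> q * (t n + g n)" by simp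
      have "real (m div (t n + g n)) * (real (t n) + real (g n)) \<le> real m"
        by (metis div_times_less_eq_dividend of_nat_add of_nat_mono of_nat_mult)
      moreover have "real (m div (t n + g n)) * real (t n) \<le> real (m div (t n + g n)) * (real (t n) + real (g n))"
        by (intro mult_left_mono) auto
      ultimately have qt: "real q * real (t n) \<le> real m + real (t n)"
        unfolding q_def of_nat_add of_nat_1 ring_distribs by linarith
      have tm: "real (t n) \<le> real m" using t m by linarith
      define y where "y = real (t n) * w n / sqrt (real n)"
      have y: "0 \<le> y" "y \<le> 1/2" using elim w unfolding y_def by auto
      have "sqrt (real n) * p \<le> w n"
        using mult_right_mono[OF m(1) p] mp by linarith
      hence "p \<le> w n / sqrt (real n)" using sq by (simp add: field_simps)
      hence "real (t n) * p \<le> real (t n) * (w n / sqrt (real n))" by (intro mult_left_mono) auto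
      hence tp: "real (t n) * p \<le> y" by (simp add: y_def)
      have qtp: "real q * real (t n) * p \<le> (1 + real (t n) / sqrt (real n)) * w n"
      proof -
        have "real q * real (t n) * p \<le> (real m + real (t n)) * p" using qt p by (intro mult_right_mono)
        also have "\<dots> \<le> w n + y" using mp tp by (simp add: algebra_simps)
        also have "\<dots> = (1 + real (t n) / sqrt (real n)) * w n" by (simp add: y_def algebra_simps)
        finally show ?thesis .
      qed
      have "ln (real n) powr (- \<theta>') = exp (- \<theta>' * ln (ln (real n)))"
        using elim by (auto simp: powr_def)
      also have "\<dots> \<le> exp (- ((1 + 2 * y) * (real q * real (t n) * p)))"
      proof -
        have "(1 + 2 * y) * (real q * real (t n) * p) \<le> (1 + 2 * y) * ((1 + real (t n) / sqrt (real n)) * w n)"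
          using y by (intro mult_left_mono qtp) auto
        also have "\<dots> = ((1 + 2 * y) * (1 + real (t n) / sqrt (real n)) * \<theta>) * ln (ln (real n))"
          by (simp add: w_def)
        also have "\<dots> \<le> \<theta>' * ln (ln (real n))"
          using elim by (intro mult_right_mono) (auto simp: y_def)
        finally show ?thesis by simp
      qed
      \<comment> \<open>Prepares the bound \<open>exp (- x - 2 * x^2) \<le> 1 - x\<close>, valid for
        \<open>x\<close> in [0, 1/2]; the quadratic term is at most
        \<open>2 * y * x\<close>.\<close>
      also have "\<dots> \<le> exp (real q * (- (real (t n) * p) - 2 * (real (t n) * p)\<^sup>2))"
      proof -
        have "(real (t n) * p)\<^sup>2 \<le> y * (real (t n) * p)"
          unfolding power2_eq_square using tp p by (intro mult_right_mono) auto
        hence "real q * (real (t n) * p + 2 * (real (t n) * p)\<^sup>2) \<le> real q * (real (t n) * p + 2 * (y * (real (t n) * p)))"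
          by (intro mult_left_mono) auto
        thus ?thesis by (simp add: algebra_simps)
      qed
      also have "\<dots> = exp (- (real (t n) * p) - 2 * (real (t n) * p)\<^sup>2) ^ q"
        by (simp only: exp_of_nat_mult)
      also have "\<dots> \<le> (1 - real (t n) * p) ^ q"
      proof (intro power_mono)
        have "0 \<le> real (t n) * p" "real (t n) * p \<le> 1/2" using tp y p by auto
        hence "exp (- (real (t n) * p) - 2 * (real (t n) * p)\<^sup>2) \<le> exp (ln (1 - real (t n) * p))"
          using ln_one_minus_pos_lower_bound[of "real (t n) * p"] by (simp only: exp_le_cancel_iff)
        also have "exp (ln (1 - real (t n) * p)) = 1 - real (t n) * p"
          using \<open>real (t n) * p \<le> 1/2\<close> by (intro exp_ln) linarith
        finally show "exp (- (real (t n) * p) - 2 * (real (t n) * p)\<^sup>2) \<le> 1 - real (t n) * p" .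
      qed auto
      finally have main: "ln (real n) powr (- \<theta>') \<le> (1 - real (t n) * p) ^ q" .
      have err1: "real q * real (t n) * (3 * C * exp (- \<tau> * real (g n))) \<le> (2 * real n) * (3 * C * exp (- \<tau> * real (g n)))"
        using C_pos qt tm m by (intro mult_right_mono) auto
      have err2: "real q * (real (g n) * p) \<le> 2 * real (g n) * w n / real (t n)"
      proof -
        have "real q * real (t n) * (real (g n) * p) \<le> (2 * real m) * (real (g n) * p)"
          using qt tm p by (intro mult_right_mono) auto
        also have "\<dots> = 2 * real (g n) * (real m * p)" by simp
        also have "\<dots> \<le> 2 * real (g n) * w n" using mp by (intro mult_left_mono) auto
        finally show ?thesis using t by (simp add: field_simps)
      qed
      have err3: "6 * real n * C * exp (- \<tau> * real (g n)) + 2 * real (g n) * w n / real (t n) \<le> 1/2 * ln (real n) powr (- \<theta>')"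
        using elim by simp
      have "real q * (real (t n) * (3 * C * exp (- \<tau> * real (g n))) + real (g n) * p) \<le> 1/2 * ln (real n) powr (- \<theta>')"
      proof -
        have "real q * (real (t n) * (3 * C * exp (- \<tau> * real (g n))) + real (g n) * p) =
            real q * real (t n) * (3 * C * exp (- \<tau> * real (g n))) + real q * (real (g n) * p)"
          by (simp only: ring_distribs mult.assoc)
        moreover have "(2 * real n) * (3 * C * exp (- \<tau> * real (g n))) = 6 * real n * C * exp (- \<tau> * real (g n))"
          by simp
        ultimately show ?thesis using err1 err2 err3 by linarith
      qed
      hence "1/2 * ln (real n) powr (- \<theta>') \<le> (1 - real (t n) * p) ^ q -
          real q * (real (t n) * (3 * C * exp (- \<tau> * real (g n))) + real (g n) * p)"
        using main by linarith
      also have "\<dots> \<le> prob (no_hit B (q * (t n + g n)))"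
        unfolding p_def using tp y by (intro no_hit_lower B) (auto simp: p_def)
      also have "\<dots> \<le> prob (no_hit B m)"
        using mq B by (intro finite_measure_mono no_hit_mono) auto
      finally show "1/2 * ln (real n) powr (- \<theta>') \<le> prob (no_hit B m)" .
    qed
  qed
qed

lemma pieces_preimage_iter:
  assumes K: "\<And>x r. x \<in> X \<Longrightarrow> r \<ge> 0 \<Longrightarrow> finite (components (preimage_iter X f 1 (rball X x r))) \<and>
          card (components (preimage_iter X f 1 (rball X x r))) \<le> K"
    and S: "pieces X m S"
  shows "pieces X (K ^ j * m) (preimage_iter X f j S)"
proof (induction j)
  case 0
  have "preimage_iter X f 0 S \<inter> F = S \<inter> F" if "F \<subseteq> X" for F using that by (auto simp: preimage_iter_def)
  thus ?case using S by (simp add: pieces_def)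
next
  case (Suc j)
  have "preimage_iter X f (Suc j) S = {x\<in>X. f x \<in> preimage_iter X f j S}"
    using funpow_in_X[of _ 1] by (auto simp: preimage_iter_def funpow_swap1)
  thus ?case
    using pieces_preimage[OF interval_X X_nonempty _ K Suc] funpow_in_X[of _ 1] by (simp add: mult.assoc)
qed

text \<open>The earliest window is the BV factor, and the later windows together form a preimage
  under \<open>f ^^ a (Suc k)\<close>. Its indicator lives on times up to \<open>b k\<close>, so it
  is made of at most \<open>b k * K ^ b k\<close> intervals, and the decay is
  \<open>exp (- \<tau> * a (Suc k))\<close>: the start of the next window counted from time 0, not
  the distance between windows.\<close>

lemma prob_all_windows_hit:
  fixes a b :: "nat \<Rightarrow> nat" and \<eta> \<epsilon> :: real
  assumes K: "\<And>x r. x \<in> X \<Longrightarrow> r \<ge> 0 \<Longrightarrow> finite (components (preimage_iter X f 1 (rball X x r))) \<and>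
          card (components (preimage_iter X f 1 (rball X x r))) \<le> K" "K \<ge> 1"
    and B: "\<And>i. pieces X 1 (B i)" "\<And>i. B i \<in> sets M"
    and a: "mono a"
    and \<eta>: "0 \<le> \<eta>" "\<eta> \<le> 1" "\<And>i. i < n \<Longrightarrow> prob (\<Union>j\<in>{a i..<b i}. preimage_iter X f j (B i)) \<le> \<eta>"
    and \<epsilon>: "\<And>i. i < n \<Longrightarrow> C * exp (- \<tau> * real (a (Suc i))) * (2 * real (b i * K ^ b i) + 1) \<le> \<epsilon>"
    and "k + L \<le> n"
  shows "prob {x\<in>X. \<forall>i\<in>{k..<k+L}. x \<in> (\<Union>j\<in>{a i..<b i}. preimage_iter X f j (B i))} \<le> \<eta> ^ L + real L * \<epsilon>"
  using \<open>k + L \<le> n\<close>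
proof (induction L arbitrary: k)
  case (Suc L)
  define W where "W i = (\<Union>j\<in>{a i..<b i}. preimage_iter X f j (B i))" for i
  have W [measurable]: "W i \<in> sets M" for i using B by (auto simp: W_def)
  \<comment> \<open>The window \<open>W i\<close> seen from time \<open>a (Suc k)\<close>. For the
    later windows monotonicity of \<open>a\<close> makes the truncated subtraction exact.\<close>
  define U where "U i = (\<Union>j\<in>{a i..<b i}. preimage_iter X f (j - a (Suc k)) (B i))" for i
  have U [measurable]: "U i \<in> sets M" for i using B by (auto simp: U_def)
  define Y where "Y = X - (\<Union>i\<in>{Suc k..<Suc k+L}. X - U i)"
  have Y [measurable]: "Y \<in> sets M" unfolding Y_def by (intro sets.Diff X_sets sets.finite_UN) auto
  have pre: "preimage_iter X f (a (Suc k)) Y = {x\<in>X. \<forall>i\<in>{Suc k..<Suc k+L}. x \<in> W i}"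
  proof -
    have W_eq: "W i = preimage_iter X f (a (Suc k)) (U i)" if "i \<ge> Suc k" for i
    proof -
      have "preimage_iter X f (a (Suc k)) (U i) =
          (\<Union>j\<in>{a i..<b i}. preimage_iter X f (a (Suc k)) (preimage_iter X f (j - a (Suc k)) (B i)))"
        unfolding U_def by (auto simp: preimage_iter_def)
      also have "\<dots> = (\<Union>j\<in>{a i..<b i}. preimage_iter X f j (B i))"
      proof (intro SUP_cong refl)
        fix j assume "j \<in> {a i..<b i}"
        hence "a (Suc k) \<le> j" using monoD[OF a, of "Suc k" i] that by simp
        thus "preimage_iter X f (a (Suc k)) (preimage_iter X f (j - a (Suc k)) (B i)) = preimage_iter X f j (B i)"
          by (simp add: preimage_preimage)
      qed
      finally show ?thesis by (simp add: W_def)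
    qed
    have "preimage_iter X f (a (Suc k)) Y = {x\<in>X. \<forall>i\<in>{Suc k..<Suc k+L}. x \<in> preimage_iter X f (a (Suc k)) (U i)}"
      using funpow_in_X unfolding Y_def preimage_iter_def by blast
    thus ?thesis using W_eq by simp
  qed
  have "pieces X (\<Sum>j\<in>{a k..<b k}. K ^ j * 1) (W k)"
    unfolding W_def by (intro pieces_UN pieces_preimage_iter K(1) B) auto
  moreover have "(\<Sum>j\<in>{a k..<b k}. K ^ j * 1) \<le> (\<Sum>j\<in>{a k..<b k}. K ^ b k)"
    using K(2) by (intro sum_mono) (auto intro!: power_increasing)
  moreover have "\<dots> \<le> b k * K ^ b k" by simp
  ultimately have pW: "pieces X (b k * K ^ b k) (W k)" using pieces_mono le_trans by blast
  have \<epsilon>0: "0 \<le> \<epsilon>"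
  proof -
    have "0 \<le> C * exp (- \<tau> * real (a (Suc k))) * (2 * real (b k * K ^ b k) + 1)" using C_pos by simp
    also have "\<dots> \<le> \<epsilon>" using \<epsilon>[of k] Suc.prems by simp
    finally show ?thesis .
  qed
  have "prob {x\<in>X. \<forall>i\<in>{k..<k+Suc L}. x \<in> W i} = prob (W k \<inter> preimage_iter X f (a (Suc k)) Y)"
  proof (intro arg_cong[of _ _ prob])
    have "{k..<k+Suc L} = insert k {Suc k..<Suc k+L}" by auto
    thus "{x\<in>X. \<forall>i\<in>{k..<k+Suc L}. x \<in> W i} = W k \<inter> preimage_iter X f (a (Suc k)) Y"
      unfolding pre using sets_subset_X[OF W] by auto
  qed
  also have "\<dots> \<le> prob (W k) * prob Y + \<epsilon>"
    using correlation[OF pW W Y, of "a (Suc k)"] \<epsilon>[of k] Suc.prems by (simp add: abs_le_iff)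
  also have "prob Y = prob {x\<in>X. \<forall>i\<in>{Suc k..<Suc k+L}. x \<in> W i}"
    using measure_preimage[OF Y, of "a (Suc k)"] by (simp add: pre)
  also have "prob (W k) * \<dots> \<le> \<eta> * (\<eta> ^ L + real L * \<epsilon>)"
    using Suc.IH[of "Suc k"] Suc.prems \<eta>(3)[of k] \<eta>(1) unfolding W_def
    by (intro mult_mono) auto
  also have "\<dots> + \<epsilon> \<le> \<eta> ^ Suc L + real (Suc L) * \<epsilon>"
  proof -
    have "\<eta> * (real L * \<epsilon>) \<le> 1 * (real L * \<epsilon>)" using \<eta> \<epsilon>0 by (intro mult_right_mono) auto
    thus ?thesis by (simp add: algebra_simps)
  qed
  finally show ?case by (simp add: W_def)
qed auto

text \<open>The smallness condition covers a full range of scales, but only for infinitely many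
  \<open>n\<close>. Along these the set \<open>Z n\<close> of points hitting at every scale of the
  range has a measurable superset of measure at most \<open>e n\<close>, which tends to 0.\<close>

lemma AE_frequently_no_hit:
  fixes B :: "nat \<Rightarrow> real set" and \<theta> :: real
  assumes B: "\<And>n. pieces X 1 (B n)" "\<And>n. B n \<in> sets M"
    and K: "\<And>x r. x \<in> X \<Longrightarrow> r \<ge> 0 \<Longrightarrow> finite (components (preimage_iter X f 1 (rball X x r))) \<and>
          card (components (preimage_iter X f 1 (rball X x r))) \<le> K"
    and \<theta>: "0 < \<theta>" "\<theta> < 1"
    and freq: "frequently (\<lambda>n. \<forall>k. sqrt (real n) \<le> real k \<longrightarrow> k \<le> n \<longrightarrow>
        real k * prob (B k) \<le> \<theta> * ln (ln (real n))) sequentially"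
  shows "AE x in M. frequently (\<lambda>n. x \<in> no_hit (B n) n) sequentially"
proof -
  \<comment> \<open>Equally spaced, \<open>\<theta> < \<theta>' < b < 1\<close>. The number of
    scales times the probability of a miss is of order \<open>(ln n)^(b - \<theta>')\<close> and
    diverges, while \<open>b < 1\<close> lets \<open>(ln n)^b\<close> scales of ratio
    \<open>(ln n)^2\<close> fit below \<open>n\<close>.\<close>
  define \<theta>' b where "\<theta>' = (2 * \<theta> + 1) / 3" and "b = (\<theta> + 2) / 3"
  have b: "\<theta> < \<theta>'" "\<theta>' < b" "b < 1" "0 < \<theta>'" "0 < b" using \<theta> by (auto simp: \<theta>'_def b_def)
  define K' where "K' = max K 1"
  have K': "finite (components (preimage_iter X f 1 (rball X x r))) \<and>
          card (components (preimage_iter X f 1 (rball X x r))) \<le> K'" if "x \<in> X" "r \<ge> 0" for x r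
    using K[OF that] by (auto simp: K'_def)
  have K'1: "K' \<ge> 1" by (simp add: K'_def)
  \<comment> \<open>A window of scale \<open>m\<close> has about \<open>K' ^ m\<close> intervals and
    the next one starts at \<open>D * m\<close>; this \<open>D\<close> leaves a net factor
    \<open>exp (- m)\<close>.\<close>
  have "eventually (\<lambda>D. exp (- \<tau> * real D) * real K' \<le> exp (- 1)) sequentially"
    using \<tau>_pos by real_asymp
  then obtain D where D: "D \<ge> 1" "exp (- \<tau> * real D) * real K' \<le> exp (- 1)"
    unfolding eventually_sequentially by (meson nle_le order_trans max.cobounded1 max.cobounded2)
  define Q L m0 where "Q n = nat \<lceil>ln (real n) ^ 2\<rceil>" and "L n = nat \<lfloor>ln (real n) powr b\<rfloor>"
    and "m0 n = nat \<lceil>sqrt (real n)\<rceil>" for n :: nat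
  define \<epsilon> where "\<epsilon> n = 3 * C * real n * exp (- sqrt (real n))" for n :: nat
  \<comment> \<open>The three terms bound the chance of hitting all windows as if independent, the
    correlation errors, and the hits before some window starts.\<close>
  define e where "e n = exp (- (1/2 * ln (real n) powr (- \<theta>') * real (L n))) + real (L n) * \<epsilon> n +
      real (L n) * (real D / real (Q n) * (\<theta> * ln (ln (real n))))" for n
  have e_lim: "e \<longlonglongrightarrow> 0"
    unfolding e_def \<epsilon>_def L_def Q_def using b \<theta> D(1) C_pos by real_asymp
  have ev1: "eventually (\<lambda>n. (sqrt (real n) + 1) * (ln (real n) ^ 2 + 1) powr (ln (real n) powr b) \<le> real n) sequentially"
    using b by real_asymp
  have ev2: "eventually (\<lambda>n. real (Q n) \<ge> real D) sequentially"
    unfolding Q_def by real_asymp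
  have ev3: "eventually (\<lambda>n::nat. ln (real n) \<ge> 1) sequentially" by real_asymp
  have ev4: "eventually (\<lambda>n::nat. 1/2 * ln (real n) powr (- \<theta>') \<le> 1) sequentially" using b by real_asymp
  define Z where "Z n = {x\<in>X. \<forall>k. sqrt (real n) \<le> real k \<longrightarrow> k \<le> n \<longrightarrow> x \<notin> no_hit (B k) k}" for n :: nat

  have "frequently (\<lambda>n. \<exists>Z'\<in>sets M. Z n \<subseteq> Z' \<and> prob Z' \<le> e n) sequentially"
  proof (rule frequently_rev_mp[OF freq])
    show "eventually (\<lambda>n. (\<forall>k. sqrt (real n) \<le> real k \<longrightarrow> k \<le> n \<longrightarrow> real k * prob (B k) \<le> \<theta> * ln (ln (real n))) \<longrightarrow>
        (\<exists>Z'\<in>sets M. Z n \<subseteq> Z' \<and> prob Z' \<le> e n)) sequentially"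
      using no_hit_lower_loglog[OF \<theta>(1) b(1)] ev1 ev2 ev3 ev4 eventually_gt_at_top[of 0]
    proof eventually_elim
      case (elim n)
      show ?case
      proof (intro impI)
        assume sm: "\<forall>k. sqrt (real n) \<le> real k \<longrightarrow> k \<le> n \<longrightarrow> real k * prob (B k) \<le> \<theta> * ln (ln (real n))"
        note lower = elim(1)[rule_format] and small = sm[rule_format]
        define m where "m i = m0 n * Q n ^ i" for i
        have Q1: "Q n \<ge> 1" using elim(3) D(1) by simp
        have m0: "sqrt (real n) \<le> real (m0 n)" "real (m0 n) \<le> sqrt (real n) + 1"
          unfolding m0_def by (auto simp: of_nat_nat)
        have m_ge: "sqrt (real n) \<le> real (m i)" for i
        proof -
          have "m0 n * 1 \<le> m i" unfolding m_def using Q1 by (intro mult_left_mono) auto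
          thus ?thesis using m0(1) by simp
        qed
        have m_le: "m i \<le> n" if i: "i \<le> L n" for i
        proof -
          have Qle: "real (Q n) \<le> ln (real n) ^ 2 + 1" unfolding Q_def by (auto simp: of_nat_nat)
          have "real (Q n) ^ i \<le> real (Q n) ^ L n" using Q1 i by (intro power_increasing) auto
          also have "\<dots> = real (Q n) powr real (L n)" using Q1 by (simp add: powr_realpow)
          also have "\<dots> \<le> (ln (real n) ^ 2 + 1) powr real (L n)"
            using Qle by (intro powr_mono2) auto
          also have "\<dots> \<le> (ln (real n) ^ 2 + 1) powr (ln (real n) powr b)"
            by (intro powr_mono) (auto simp: L_def of_nat_nat)
          finally have "real (m0 n) * real (Q n) ^ i \<le> (sqrt (real n) + 1) * (ln (real n) ^ 2 + 1) powr (ln (real n) powr b)"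
            using m0(2) by (intro mult_mono) auto
          hence "real (m i) \<le> real n" using elim(2) by (simp add: m_def)
          thus ?thesis by simp
        qed
        define a where "a i = D * m i" for i
        define W where "W i = (\<Union>j\<in>{a i..<m (Suc i)}. preimage_iter X f j (B (m (Suc i))))" for i
        define E where "E i = (\<Union>j<a i. preimage_iter X f j (B (m (Suc i))))" for i
        define T where "T = {x\<in>X. \<forall>i\<in>{0..<0+L n}. x \<in> W i}"
        define v where "v = 1/2 * ln (real n) powr (- \<theta>')"
        have v: "0 \<le> v" "v \<le> 1" using elim(5) by (auto simp: v_def)
        have [measurable]: "W i \<in> sets M" "E i \<in> sets M" for i using B by (auto simp: W_def E_def)
        have T_sets: "T \<in> sets M"
        proof -
          have "T = X - (\<Union>i\<in>{0..<0+L n}. X - W i)" by (auto simp: T_def)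
          thus ?thesis by (simp only:) (intro sets.Diff X_sets sets.finite_UN, auto)
        qed
        have prob_T: "prob T \<le> (1 - v) ^ L n + real (L n) * \<epsilon> n"
          unfolding T_def W_def
        proof (rule prob_all_windows_hit[OF K' K'1 B])
          show "mono a" unfolding a_def m_def using Q1 by (intro monoI mult_left_mono power_increasing) auto
          show "0 \<le> 1 - v" "1 - v \<le> 1" "0 + L n \<le> L n" using v by auto
          fix i assume i: "i < L n"
          have le: "m (Suc i) \<le> n" using m_le[of "Suc i"] i by simp
          have "v \<le> prob (no_hit (B (m (Suc i))) (m (Suc i)))"
            unfolding v_def using lower[OF B m_ge le small[OF m_ge le]] .
          moreover have "prob (W i) \<le> prob (X - no_hit (B (m (Suc i))) (m (Suc i)))"
            using B by (intro finite_measure_mono) (auto simp: W_def no_hit_def preimage_iter_def)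
          moreover have "\<dots> = 1 - prob (no_hit (B (m (Suc i))) (m (Suc i)))"
            using prob_compl[of "no_hit (B (m (Suc i))) (m (Suc i))"] B by (simp add: space_M)
          ultimately show "prob (\<Union>j\<in>{a i..<m (Suc i)}. preimage_iter X f j (B (m (Suc i)))) \<le> 1 - v"
            by (simp add: W_def)
          define M' where "M' = m (Suc i)"
          have M': "M' \<ge> 1" "M' \<le> n" "sqrt (real n) \<le> real M'"
            using le m_ge[of "Suc i"] elim(6) unfolding M'_def
            by (auto simp: Suc_le_eq intro: gr0I)
          have "2 * real (M' * K' ^ M') + 1 \<le> 3 * real (M' * K' ^ M')"
          proof -
            have "1 * 1 \<le> M' * K' ^ M'" using M' K'1 by (intro mult_mono) auto
            hence "1 \<le> real (M' * K' ^ M')" by linarith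
            thus ?thesis by linarith
          qed
          hence "C * exp (- \<tau> * real (a (Suc i))) * (2 * real (M' * K' ^ M') + 1) \<le>
              C * exp (- \<tau> * real (a (Suc i))) * (3 * real (M' * K' ^ M'))"
            using C_pos by (intro mult_left_mono) auto
          also have "C * exp (- \<tau> * real (a (Suc i))) * (3 * real (M' * K' ^ M')) =
              C * exp (- \<tau> * real D) ^ M' * (3 * real (M' * K' ^ M'))"
            by (simp add: a_def M'_def exp_of_nat_mult[symmetric] mult_ac)
          also have "C * exp (- \<tau> * real D) ^ M' * (3 * real (M' * K' ^ M')) =
              3 * C * real M' * (exp (- \<tau> * real D) * real K') ^ M'"
            by (simp add: power_mult_distrib)
          also have "\<dots> \<le> 3 * C * real M' * exp (- 1) ^ M'"
            using C_pos D(2) by (intro mult_left_mono power_mono) auto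
          also have "exp (- 1) ^ M' = exp (- real M')"
            by (simp add: exp_of_nat_mult[symmetric])
          also have "3 * C * real M' * exp (- real M') \<le> 3 * C * real n * exp (- sqrt (real n))"
            using C_pos M' by (intro mult_mono) auto
          finally show "C * exp (- \<tau> * real (a (Suc i))) * (2 * real (m (Suc i) * K' ^ m (Suc i)) + 1) \<le> \<epsilon> n"
            unfolding M'_def \<epsilon>_def .
        qed
        \<comment> \<open>Before the window there are only \<open>D / Q n\<close> times
          \<open>m (Suc i)\<close> steps, so the large ratio \<open>Q n\<close> of scales makes
          early hits rare even when summed over all scales.\<close>
        have prob_E: "prob (E i) \<le> real D / real (Q n) * (\<theta> * ln (ln (real n)))" if i: "i < L n" for i
        proof -
          have le: "m (Suc i) \<le> n" using m_le[of "Suc i"] i by simp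
          have "prob (E i) \<le> (\<Sum>j<a i. prob (preimage_iter X f j (B (m (Suc i)))))"
            unfolding E_def using B by (intro finite_measure_subadditive_finite) auto
          also have "\<dots> = real (a i) * prob (B (m (Suc i)))" using B by (simp add: measure_preimage)
          also have "real (a i) = real D / real (Q n) * real (m (Suc i))"
            using Q1 by (simp add: a_def m_def field_simps)
          also have "\<dots> * prob (B (m (Suc i))) = real D / real (Q n) * (real (m (Suc i)) * prob (B (m (Suc i))))"
            by simp
          also have "\<dots> \<le> real D / real (Q n) * (\<theta> * ln (ln (real n)))"
            using small[OF m_ge le] by (intro mult_left_mono) auto
          finally show ?thesis .
        qed
        define E' where "E' = (\<Union>i<L n. E i)"
        have E'_sets: "E' \<in> sets M" by (auto simp: E'_def)
        have "prob E' \<le> (\<Sum>i<L n. prob (E i))"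
          unfolding E'_def by (intro finite_measure_subadditive_finite) auto
        also have "\<dots> \<le> (\<Sum>i<L n. real D / real (Q n) * (\<theta> * ln (ln (real n))))"
          using prob_E by (intro sum_mono) auto
        finally have prob_E': "prob E' \<le> real (L n) * (real D / real (Q n) * (\<theta> * ln (ln (real n))))" by simp
        have "(1 - v) ^ L n \<le> exp (- v) ^ L n"
          using v exp_ge_add_one_self[of "- v"] by (intro power_mono) auto
        also have "\<dots> = exp (- (v * real (L n)))" by (simp add: exp_of_nat_mult[symmetric] mult.commute)
        finally have pow: "(1 - v) ^ L n \<le> exp (- (v * real (L n)))" .
        have "prob (T \<union> E') \<le> prob T + prob E'" using T_sets E'_sets by (rule measure_Un_le)
        also have "\<dots> \<le> e n" unfolding e_def v_def[symmetric] using prob_T prob_E' pow by linarith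
        finally have "prob (T \<union> E') \<le> e n" .
        moreover have "Z n \<subseteq> T \<union> E'"
        proof
          fix x assume x: "x \<in> Z n"
          show "x \<in> T \<union> E'"
          proof (cases "x \<in> E'")
            case False
            have "x \<in> W i" if i: "i < L n" for i
            proof -
              have "x \<notin> no_hit (B (m (Suc i))) (m (Suc i))" "x \<in> X"
                using x m_ge[of "Suc i"] m_le[of "Suc i"] i by (auto simp: Z_def)
              then obtain k where k: "k < m (Suc i)" "x \<in> preimage_iter X f k (B (m (Suc i)))"
                by (auto simp: no_hit_def preimage_iter_def)
              moreover have "x \<notin> E i" using False i by (auto simp: E'_def)
              hence "\<not> k < a i" using k(2) by (auto simp: E_def)
              ultimately show ?thesis by (auto simp: W_def)
            qed
            thus ?thesis using x by (auto simp: T_def Z_def)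
          qed auto
        qed
        ultimately show "\<exists>Z'\<in>sets M. Z n \<subseteq> Z' \<and> prob Z' \<le> e n" using T_sets E'_sets by blast
      qed
    qed
  qed
  note Z = this
  have "AE x in M. \<exists>n\<ge>N. x \<in> no_hit (B n) n" for N
  proof -
    \<comment> \<open>Points that hit at every index from \<open>N\<close> on lie in
      \<open>Z n\<close> as soon as the square root of \<open>n\<close> reaches \<open>N\<close>. A
      fixed set below a null sequence of measures is null.\<close>
    define Bad where "Bad = X - (\<Union>n\<in>{N..}. no_hit (B n) n)"
    have Bad_sets [measurable]: "Bad \<in> sets M" unfolding Bad_def using B by auto
    have "prob Bad = 0"
    proof (rule ccontr)
      assume "prob Bad \<noteq> 0"
      hence "prob Bad > 0" using measure_nonneg[of M Bad] by linarith
      hence "eventually (\<lambda>n. e n < prob Bad) sequentially"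
        using e_lim by (simp add: order_tendstoD)
      moreover have "eventually (\<lambda>n. real N \<le> sqrt (real n)) sequentially" by real_asymp
      ultimately have "eventually (\<lambda>n. \<not> (\<exists>Z'\<in>sets M. Z n \<subseteq> Z' \<and> prob Z' \<le> e n)) sequentially"
      proof eventually_elim
        case (elim n)
        have sub: "Bad \<subseteq> Z n"
          using elim(2) by (auto simp: Bad_def Z_def)
        show ?case
        proof
          assume "\<exists>Z'\<in>sets M. Z n \<subseteq> Z' \<and> prob Z' \<le> e n"
          then obtain Z' where Z': "Z' \<in> sets M" "Z n \<subseteq> Z'" "prob Z' \<le> e n" by blast
          have "prob Bad \<le> prob Z'" using sub Z' by (intro finite_measure_mono) auto
          thus False using Z' elim(1) by simp
        qed
      qed
      thus False using Z by (simp add: frequently_def)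
    qed
    hence "AE x in M. x \<notin> Bad" by (subst prob_eq_0[symmetric]) auto
    moreover have "AE x in M. x \<in> X" by (intro AE_I2) (simp add: space_M)
    ultimately show ?thesis by eventually_elim (auto simp: Bad_def)
  qed
  hence "AE x in M. \<forall>N. \<exists>n\<ge>N. x \<in> no_hit (B n) n" by (subst AE_all_countable) blast
  thus ?thesis by eventually_elim (simp add: frequently_sequentially)
qed

end

section \<open>Open and closed balls, and the Dirac case\<close>

context decay_system begin

text \<open>Closed balls are the exceedance sets of \<open>\<phi>\<close>, as \<open>\<psi>\<close>
  is strictly decreasing.\<close>

definition rcball :: "real \<Rightarrow> real \<Rightarrow> real set" where
  "rcball x r = {y\<in>X. dist x y \<le> r}"

lemma rcball_eq: "rcball x r = X \<inter> {x - r..x + r}"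
  by (auto simp: rcball_def dist_real_def)

lemma rcball_sets [measurable]: "rcball x r \<in> sets M"
  unfolding rcball_eq by (rule Int_borel_sets) auto

lemma pieces_rcball: "pieces X 1 (rcball x r)"
  unfolding pieces_def rcball_eq using interval_X
  by (intro allI impI exI[of _ "{X \<inter> {x - r..x + r}}"]) (auto intro!: is_interval_Int is_interval_cc)

lemma rball_subset_rcball: "rball X x r \<subseteq> rcball x r"
  by (auto simp: rball_def rcball_def)

text \<open>Common form of \<open>H_ea\<close> (open balls) and of the event that the running
  maximum eventually stays above its level (closed balls).\<close>

definition ev_hit :: "(nat \<Rightarrow> real set) \<Rightarrow> (nat \<Rightarrow> nat) \<Rightarrow> real set" where
  "ev_hit S N = {x\<in>X. \<forall>\<^sub>F n in sequentially. x \<notin> no_hit (S n) (N n)}"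

lemma ev_hit_sets [measurable]:
  assumes "\<And>n. S n \<in> sets M"
  shows "ev_hit S N \<in> sets M"
proof -
  have "ev_hit S N = X - (\<Inter>k. \<Union>n\<in>{k..}. no_hit (S n) (N n))"
    by (auto simp: ev_hit_def eventually_sequentially)
  thus ?thesis using assms by auto
qed

lemma prob_ev_hit_eq_1:
  assumes "\<And>n. S n \<in> sets M" "AE x in M. \<forall>\<^sub>F n in sequentially. x \<notin> no_hit (S n) (N n)"
  shows "prob (ev_hit S N) = 1"
proof -
  have "AE x in M. x \<in> X" by (intro AE_I2) (simp add: space_M)
  hence "AE x in M. x \<in> ev_hit S N" using assms(2) by eventually_elim (simp add: ev_hit_def)
  thus ?thesis using assms(1) by (subst prob_eq_1) auto
qed

lemma prob_ev_hit_eq_0: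
  assumes "\<And>n. S n \<in> sets M" "AE x in M. \<exists>\<^sub>F n in sequentially. x \<in> no_hit (S n) (N n)"
  shows "prob (ev_hit S N) = 0"
proof -
  have "AE x in M. x \<notin> ev_hit S N"
    using assms(2) by eventually_elim (auto simp: ev_hit_def frequently_def)
  thus ?thesis using assms(1) by (subst prob_eq_0) auto
qed

lemma dirac_or_nonatomic:
  obtains (dirac) p where "p \<in> X" "prob {p} = 1" | (nonatomic) "\<And>p. prob {p} = 0"
proof (cases "\<exists>p. prob {p} \<noteq> 0")
  case True
  then obtain p where p: "prob {p} \<noteq> 0" by blast
  \<comment> \<open>Sets outside the sigma-algebra have measure 0 by convention.\<close>
  hence "{p} \<in> sets M" using measure_notin_sets by blast
  hence "p \<in> X" using sets_subset_X by auto
  thus ?thesis using dirac atom_imp_dirac p by blast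
next
  case False
  thus ?thesis by (intro nonatomic) blast
qed

lemma nonatomic_decay_systemI:
  assumes "\<And>p. prob {p} = 0"
  shows "nonatomic_decay_system M X f C \<tau>"
  by unfold_locales (rule assms)

lemma dirac_AE:
  assumes "p \<in> X" "prob {p} = 1"
  shows "AE x in M. x = p"
  using assms singleton_sets[OF assms(1)] prob_eq_1[of "{p}"] by simp

lemma dirac_prob_eq_0:
  assumes "p \<in> X" "prob {p} = 1" "A \<in> sets M" "p \<notin> A"
  shows "prob A = 0"
  using dirac_AE[OF assms(1,2)] assms(3,4) by (subst prob_eq_0) auto

lemma dirac_prob_eq_1:
  assumes "p \<in> X" "prob {p} = 1" "A \<in> sets M" "p \<in> A"
  shows "prob A = 1"
  using dirac_AE[OF assms(1,2)] assms(3,4) by (subst prob_eq_1) auto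

lemma dirac_at_center_hit:
  assumes "p \<in> X" "prob {p} = 1" "\<And>n. n \<ge> 1 \<Longrightarrow> r n > 0" "\<And>n. n \<ge> 1 \<Longrightarrow> N n > 0"
  shows "AE x in M. \<forall>\<^sub>F n in sequentially. x \<notin> no_hit (rball X p (r n)) (N n)"
  using dirac_AE[OF assms(1,2)]
proof eventually_elim
  case (elim x)
  show ?case using eventually_ge_at_top[of "1::nat"]
  proof eventually_elim
    case (elim n)
    have "(f ^^ 0) x \<in> rball X p (r n)" using \<open>x = p\<close> assms(1,3) elim by (simp add: rball_def)
    thus ?case using assms(4)[OF elim] by (auto simp: no_hit_def)
  qed
qed

lemma dirac_off_center_null:
  assumes p: "p \<in> X" "prob {p} = 1" "p \<noteq> x0" and r: "r \<longlonglongrightarrow> 0"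
  shows "eventually (\<lambda>n. prob (rcball x0 (r n)) = 0) sequentially"
proof -
  have "eventually (\<lambda>n. r n < dist x0 p) sequentially"
    using order_tendstoD(2)[OF r, of "dist x0 p"] p by simp
  thus ?thesis
  proof eventually_elim
    case (elim n)
    show ?case by (rule dirac_prob_eq_0[OF p(1,2) rcball_sets]) (use elim in \<open>simp add: rcball_def\<close>)
  qed
qed

section \<open>Almost sure statements for a fixed sequence of radii\<close>

context
  fixes r :: "nat \<Rightarrow> real" and x0 :: real
  assumes r_pos: "\<And>n. n \<ge> 1 \<Longrightarrow> r n > 0" and r_mono: "antimono_on {1..} r" and r_lim: "r \<longlonglongrightarrow> 0"
    and mass_mono: "mono_on {1..} (\<lambda>n. real n * prob (rball X x0 (r n)))"
begin

text \<open>A Dirac mass must sit at \<open>x0\<close>: the open ball around \<open>x0\<close>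
  reaching just to \<open>p\<close> misses \<open>p\<close>, contradicting \<open>pos\<close>. Then
  the orbit hits at time 0.\<close>

lemma AE_eventually_hit_series:
  assumes A2: "short_return_times M f x0" and pos: "\<forall>\<rho>>0. prob (rball X x0 \<rho>) > 0"
    and summ: "summable (\<lambda>n. prob (rball X x0 (r n)) * exp (- real n * prob (rball X x0 (r n))))"
    and a: "a > 1"
  shows "AE x in M. \<forall>\<^sub>F n in sequentially. x \<notin> no_hit (rball X x0 (r n)) (nat \<lceil>a * real n\<rceil>)"
proof (cases rule: dirac_or_nonatomic)
  case (dirac p)
  have "p = x0"
  proof (rule ccontr)
    assume "p \<noteq> x0"
    moreover have "prob (rball X x0 (dist x0 p)) = 0"
      by (rule dirac_prob_eq_0[OF dirac(1,2) rball_sets]) (simp add: rball_def)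
    moreover have "dist x0 p > 0" using \<open>p \<noteq> x0\<close> by simp
    ultimately show False using pos by (metis less_irrefl)
  qed
  thus ?thesis using dirac r_pos a by (intro dirac_at_center_hit) auto
next
  case nonatomic
  interpret nonatomic_decay_system M X f C \<tau> by (rule nonatomic_decay_systemI) (rule nonatomic)
  show ?thesis
    using pos r_pos[of 1] by (intro AE_eventually_hit_of_series A2 r_mono mass_mono summ a) auto
qed

text \<open>The lower bound makes the balls eventually charged. This excludes a Dirac mass away from
  \<open>x0\<close>, and without atoms it gives positive mass to the first and largest ball.\<close>

lemma AE_eventually_hit_loglog:
  assumes A2: "short_return_times M f x0" and c: "c > 1"
    and lower: "eventually (\<lambda>n. prob (rcball x0 (r n)) \<ge> c * (ln (ln (real n)) / real n)) sequentially"
  shows "AE x in M. \<forall>\<^sub>F n in sequentially. x \<notin> no_hit (rball X x0 (r n)) n"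
proof -
  have "eventually (\<lambda>n::nat. c * (ln (ln (real n)) / real n) > 0) sequentially" using c by real_asymp
  hence pos: "eventually (\<lambda>n. prob (rcball x0 (r n)) > 0) sequentially"
    using lower by eventually_elim linarith
  show ?thesis
  proof (cases rule: dirac_or_nonatomic)
    case (dirac p)
    have "p = x0"
    proof (rule ccontr)
      assume "p \<noteq> x0"
      have "eventually (\<lambda>n. False) sequentially"
        using pos dirac_off_center_null[OF dirac(1,2) \<open>p \<noteq> x0\<close> r_lim] by eventually_elim simp
      thus False by simp
    qed
    thus ?thesis using dirac r_pos by (intro dirac_at_center_hit) auto
  next
    case nonatomic
    interpret nonatomic_decay_system M X f C \<tau> by (rule nonatomic_decay_systemI) (rule nonatomic)
    have eq: "prob (rcball x0 (r n)) = prob (rball X x0 (r n))" for n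
      unfolding rcball_def by (rule prob_cball_eq)
    obtain n where n: "n \<ge> 1" "prob (rball X x0 (r n)) > 0"
      using eventually_conj[OF pos eventually_ge_at_top[of 1]] unfolding eq
      by (auto simp: eventually_sequentially)
    have "prob (rball X x0 (r n)) \<le> prob (rball X x0 (r 1))"
      using monotone_onD[OF r_mono, of 1 n] n by (intro finite_measure_mono rball_mono) auto
    thus ?thesis
      using n lower by (intro AE_eventually_hit_of_loglog[of x0 r c] A2 r_mono mass_mono c) (auto simp: eq)
  qed
qed

context
  fixes K :: nat
  assumes K: "\<And>x r. x \<in> X \<Longrightarrow> r \<ge> 0 \<Longrightarrow> finite (components (preimage_iter X f 1 (rball X x r))) \<and>
          card (components (preimage_iter X f 1 (rball X x r))) \<le> K"
begin

lemma AE_frequently_no_hit_loglog: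
  assumes c: "c < 1"
    and upper: "eventually (\<lambda>n. prob (rcball x0 (r n)) \<le> c * (ln (ln (real n)) / real n)) sequentially"
  shows "AE x in M. \<exists>\<^sub>F n in sequentially. x \<in> no_hit (rcball x0 (r n)) n"
proof (rule AE_frequently_no_hit[OF pieces_rcball rcball_sets K])
  \<comment> \<open>\<open>c\<close> may be zero or negative, whereas \<open>\<theta>\<close> has to
    be positive.\<close>
  define \<theta> where "\<theta> = max c (1/2)"
  show \<theta>: "0 < \<theta>" "\<theta> < 1" using c by (auto simp: \<theta>_def)
  have "eventually (\<lambda>n::nat. ln (ln (real n)) > 0) sequentially" "eventually (\<lambda>n::nat. ln (real n) > 0) sequentially"
    by real_asymp+
  with upper eventually_gt_at_top[of 0]
  have "eventually (\<lambda>n. real n * prob (rcball x0 (r n)) \<le> \<theta> * ln (ln (real n)) \<and> ln (real n) > 0 \<and> n > 0) sequentially"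
  proof eventually_elim
    case (elim n)
    have "real n * prob (rcball x0 (r n)) \<le> c * ln (ln (real n))" using elim by (simp add: field_simps)
    also have "\<dots> \<le> \<theta> * ln (ln (real n))" using elim by (intro mult_right_mono) (auto simp: \<theta>_def)
    finally show ?case using elim by simp
  qed
  then obtain N where N: "\<And>n. n \<ge> N \<Longrightarrow> real n * prob (rcball x0 (r n)) \<le> \<theta> * ln (ln (real n)) \<and> ln (real n) > 0 \<and> n > 0"
    by (auto simp: eventually_sequentially)
  have "eventually (\<lambda>n. real N \<le> sqrt (real n)) sequentially" by real_asymp
  hence "eventually (\<lambda>n. \<forall>k. sqrt (real n) \<le> real k \<longrightarrow> k \<le> n \<longrightarrow>
        real k * prob (rcball x0 (r k)) \<le> \<theta> * ln (ln (real n))) sequentially"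
  proof (eventually_elim, intro allI impI)
    fix n k :: nat
    assume "real N \<le> sqrt (real n)" "sqrt (real n) \<le> real k" and kn: "k \<le> n"
    hence k: "k \<ge> N" by linarith
    have "real k * prob (rcball x0 (r k)) \<le> \<theta> * ln (ln (real k))" using N[OF k] by blast
    also have "\<dots> \<le> \<theta> * ln (ln (real n))"
      using N[OF k] N[of n] k kn \<theta> by (intro mult_left_mono) auto
    finally show "real k * prob (rcball x0 (r k)) \<le> \<theta> * ln (ln (real n))" .
  qed
  thus "\<exists>\<^sub>F n in sequentially. \<forall>k. sqrt (real n) \<le> real k \<longrightarrow> k \<le> n \<longrightarrow>
        real k * prob (rcball x0 (r k)) \<le> \<theta> * ln (ln (real n))"
    by (rule eventually_frequently[rotated]) simp
qed

text \<open>If \<open>n * p n\<close> eventually exceeded \<open>\<theta> * ln (ln n)\<close>, the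
  series would converge. So the reverse bound holds for infinitely many \<open>n\<close>, and
  monotonicity of \<open>n * p n\<close> spreads it to every \<open>k \<le> n\<close>. For a Dirac
  measure the series converges: geometrically at the centre, with finitely many nonzero terms
  elsewhere.\<close>

lemma AE_frequently_no_hit_series:
  assumes \<gamma>: "\<gamma> > 1"
    and div: "\<not> summable (\<lambda>n. prob (rball X x0 (r n)) * exp (- real n * \<gamma> * prob (rball X x0 (r n))))"
  shows "AE x in M. \<exists>\<^sub>F n in sequentially. x \<in> no_hit (rcball x0 (r n)) n"
proof (cases rule: dirac_or_nonatomic)
  case (dirac p)
  have "summable (\<lambda>n. prob (rball X x0 (r n)) * exp (- real n * \<gamma> * prob (rball X x0 (r n))))"
  proof (cases "p = x0")
    case True
    have "summable (\<lambda>n. exp (- \<gamma>) ^ n)" using \<gamma> by (intro summable_geometric) simp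
    moreover have "eventually (\<lambda>n. exp (- \<gamma>) ^ n = prob (rball X x0 (r n)) * exp (- real n * \<gamma> * prob (rball X x0 (r n)))) sequentially"
      using eventually_ge_at_top[of 1]
    proof eventually_elim
      case (elim n)
      have "prob (rball X x0 (r n)) = 1"
        by (rule dirac_prob_eq_1[OF dirac(1,2) rball_sets]) (use dirac True r_pos[OF elim] in \<open>simp add: rball_def\<close>)
      thus ?case by (simp add: exp_of_nat_mult[symmetric])
    qed
    ultimately show ?thesis using summable_cong by metis
  next
    case False
    have "eventually (\<lambda>n. prob (rball X x0 (r n)) * exp (- real n * \<gamma> * prob (rball X x0 (r n))) = 0) sequentially"
      using dirac_off_center_null[OF dirac(1,2) False r_lim]
    proof eventually_elim
      case (elim n)
      have "prob (rball X x0 (r n)) \<le> prob (rcball x0 (r n))"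
        by (intro finite_measure_mono rball_subset_rcball) auto
      thus ?case using elim measure_nonneg[of M "rball X x0 (r n)"] by simp
    qed
    thus ?thesis by (subst summable_cong[of _ "\<lambda>_. 0"]) auto
  qed
  thus ?thesis using div by contradiction
next
  case nonatomic
  interpret nonatomic_decay_system M X f C \<tau> by (rule nonatomic_decay_systemI) (rule nonatomic)
  define p where "p n = prob (rball X x0 (r n))" for n
  have eq: "prob (rcball x0 (r n)) = p n" for n
    unfolding rcball_def p_def by (rule prob_cball_eq)
  \<comment> \<open>The midpoint of \<open>1 / \<gamma>\<close> and 1; then \<open>\<gamma>'\<close>
    is the midpoint of \<open>1 / \<theta>\<close> and \<open>\<gamma>\<close>, which gives
    \<open>\<gamma>' * \<theta> > 1\<close>.\<close>
  define \<theta> where "\<theta> = (\<gamma> + 1) / (2 * \<gamma>)"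
  define \<gamma>' where "\<gamma>' = (1 / \<theta> + \<gamma>) / 2"
  have \<theta>: "0 < \<theta>" "\<theta> < 1" using \<gamma> by (auto simp: \<theta>_def field_simps)
  have "1 / \<theta> < \<gamma>" using \<gamma> by (simp add: \<theta>_def field_simps)
  hence \<gamma>': "1 / \<theta> < \<gamma>'" "\<gamma>' < \<gamma>" by (auto simp: \<gamma>'_def)
  have \<gamma>'0: "0 < \<gamma>'" using \<theta> \<gamma>'(1) by (meson less_trans zero_less_divide_1_iff)
  have \<theta>\<gamma>: "\<gamma>' * \<theta> > 1" using \<gamma>'(1) \<theta> by (simp add: field_simps)
  have freq: "\<exists>\<^sub>F n in sequentially. real n * p n \<le> \<theta> * ln (ln (real n))"
  proof (rule ccontr)
    assume "\<not> ?thesis"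
    hence large: "\<forall>\<^sub>F n in sequentially. real n * p n > \<theta> * ln (ln (real n))"
      by (simp add: not_frequently not_le)
    have "summable (\<lambda>n. p n * exp (- real n * \<gamma> * p n))"
    proof (rule summable_comparison_test_ev)
      have "eventually (\<lambda>n::nat. ln (real n) > 0) sequentially" by real_asymp
      thus "\<forall>\<^sub>F n in sequentially. norm (p n * exp (- real n * \<gamma> * p n)) \<le>
          1 / (\<gamma> - \<gamma>') * (1 / (real n * ln (real n) powr (\<gamma>' * \<theta>)))"
        using large eventually_gt_at_top[of 0]
      proof eventually_elim
        case (elim n)
        define w where "w = real n * p n"
        have w0: "0 \<le> w" by (simp add: w_def p_def)
        \<comment> \<open>Part of the exponent is spent on the factor \<open>w = n * p n\<close>,
          which is unbounded here; the rest, \<open>\<gamma>'\<close>, still gives a summable power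
          of the logarithm.\<close>
        have "(\<gamma> - \<gamma>') * w \<le> exp ((\<gamma> - \<gamma>') * w)"
          using exp_ge_add_one_self[of "(\<gamma> - \<gamma>') * w"] by linarith
        hence "w \<le> exp ((\<gamma> - \<gamma>') * w) / (\<gamma> - \<gamma>')" using \<gamma>' by (simp add: field_simps)
        hence "w * exp (- \<gamma> * w) \<le> exp ((\<gamma> - \<gamma>') * w) / (\<gamma> - \<gamma>') * exp (- \<gamma> * w)"
          by (intro mult_right_mono) auto
        also have "\<dots> = 1 / (\<gamma> - \<gamma>') * exp ((\<gamma> - \<gamma>') * w + (- \<gamma> * w))"
          unfolding exp_add by simp
        also have "(\<gamma> - \<gamma>') * w + (- \<gamma> * w) = - \<gamma>' * w" by (simp add: algebra_simps)
        also have "exp (- \<gamma>' * w) \<le> exp (- (\<gamma>' * \<theta>) * ln (ln (real n)))"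
          using elim \<gamma>'0 by (simp add: w_def mult.assoc)
        also have "exp (- (\<gamma>' * \<theta>) * ln (ln (real n))) = 1 / ln (real n) powr (\<gamma>' * \<theta>)"
          using elim by (auto simp: powr_def exp_minus inverse_eq_divide)
        finally have "w * exp (- \<gamma> * w) \<le> 1 / (\<gamma> - \<gamma>') * (1 / ln (real n) powr (\<gamma>' * \<theta>))"
          using \<gamma>' by (simp add: divide_right_mono)
        hence "w * exp (- \<gamma> * w) / real n \<le> 1 / (\<gamma> - \<gamma>') * (1 / ln (real n) powr (\<gamma>' * \<theta>)) / real n"
          by (intro divide_right_mono) auto
        also have "w * exp (- \<gamma> * w) / real n = p n * exp (- real n * \<gamma> * p n)"
          using elim by (simp add: w_def mult_ac)
        finally have "p n * exp (- real n * \<gamma> * p n) \<le> 1 / (\<gamma> - \<gamma>') * (1 / (real n * ln (real n) powr (\<gamma>' * \<theta>)))"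
          by (simp add: mult_ac)
        moreover have "0 \<le> p n * exp (- real n * \<gamma> * p n)" by (simp add: p_def)
        ultimately show ?case by (simp only: real_norm_def abs_of_nonneg)
      qed
    qed (intro summable_mult summable_inverse_n_ln_powr \<theta>\<gamma>)
    thus False using div by (simp add: p_def)
  qed
  show ?thesis
  proof (rule AE_frequently_no_hit[OF pieces_rcball rcball_sets K \<theta>])
    show "\<exists>\<^sub>F n in sequentially. \<forall>k. sqrt (real n) \<le> real k \<longrightarrow> k \<le> n \<longrightarrow>
        real k * prob (rcball x0 (r k)) \<le> \<theta> * ln (ln (real n))"
      unfolding eq
    proof (rule frequently_rev_mp[OF freq], rule eventually_mono[OF eventually_gt_at_top[of 0]], intro impI allI)
      fix n k :: nat
      assume n: "0 < n" "real n * p n \<le> \<theta> * ln (ln (real n))" and k: "sqrt (real n) \<le> real k" "k \<le> n"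
      have "k \<ge> 1" using n k(1) by (cases k) auto
      hence "real k * p k \<le> real n * p n" using mono_onD[OF mass_mono, of k n] k by (simp add: p_def)
      thus "real k * p k \<le> \<theta> * ln (ln (real n))" using n by linarith
    qed
  qed
qed

end
end
end

theorem theorem3p4:
  fixes X :: "real set" and M :: "real measure" and f :: "real \<Rightarrow> real"
    and \<psi> :: "real \<Rightarrow> ereal" and x0 :: real and \<phi> :: "real \<Rightarrow> ereal"
    and r :: "nat \<Rightarrow> real" and u :: "nat \<Rightarrow> ereal" and \<mu>B :: "nat \<Rightarrow> real"
  assumes "is_interval X"
    and "sets M = sets (restrict_space borel X)"
    and "ergodic_measure M f"
    and "exp_decay_BV_Linf M f"
    and "x0 \<in> X"
    and "\<forall>y\<ge>0. \<psi> y \<noteq> -\<infinity>"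
    and "strict_antimono_on {0..} \<psi>"
    and "continuous_on {0..} \<psi>"
    and "(\<psi> \<longlongrightarrow> \<infinity>) (at_right 0)"
    and \<phi>_eq: "\<And>x. \<phi> x = \<psi> (dist x x0)"
    and "short_return_times M f x0"
    and "\<forall>n\<ge>1. r n > 0"
    and "antimono_on {1..} r"
    and "r \<longlonglongrightarrow> 0"
    and \<mu>B_eq: "\<And>n. \<mu>B n = measure M (rball X x0 (r n))"
    and "mono_on {1..} (\<lambda>n. real n * \<mu>B n)"
    and u_eq: "\<And>n. u n = \<psi> (r n)"
  shows
    "((\<forall>\<rho>>0. measure M (rball X x0 \<rho>) > 0) \<longrightarrow>
        summable (\<lambda>n. \<mu>B n * exp (- real n * \<mu>B n)) \<longrightarrow>
        (\<forall>a>1. measure M (eventually_set X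
           (\<lambda>n x. running_max \<phi> f n x \<ge> \<psi> (r (nat \<lfloor>real n / a\<rfloor>)))) = 1)) \<and>
     ((\<exists>c>1. \<forall>\<^sub>F n in sequentially.
          measure M {x \<in> X. \<phi> x \<ge> u n} \<ge> c * (ln (ln (real n)) / real n)) \<longrightarrow>
        measure M (H_ea X f x0 r) = 1 \<and>
        measure M (eventually_set X (\<lambda>n x. u n \<le> running_max \<phi> f n x)) = 1) \<and>
     ((\<exists>K::nat. \<forall>\<rho>\<ge>0. \<forall>x\<in>X.
          finite (components (preimage_iter X f 1 (rball X x \<rho>))) \<and>
          card (components (preimage_iter X f 1 (rball X x \<rho>))) \<le> K) \<longrightarrow>
        ((\<exists>\<gamma>>1. \<not> summable (\<lambda>n. \<mu>B n * exp (- real n * \<gamma> * \<mu>B n))) \<longrightarrow>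
           measure M (H_ea X f x0 r) = 0 \<and>
           measure M (eventually_set X (\<lambda>n x. \<psi> (r n) \<le> running_max \<phi> f n x)) = 0) \<and>
        ((\<exists>c<1. \<forall>\<^sub>F n in sequentially.
            measure M {x \<in> X. \<phi> x \<ge> u n} \<le> c * (ln (ln (real n)) / real n)) \<longrightarrow>
           measure M (H_ea X f x0 r) = 0 \<and>
           measure M (eventually_set X (\<lambda>n x. u n \<le> running_max \<phi> f n x)) = 0))"
proof -
  have prob: "prob_space M" and f_meas: "f \<in> M \<rightarrow>\<^sub>M M" and f_inv: "distr M M f = M"
    using assms(3) by (auto simp: ergodic_measure_def invariant_measure_def)
  have space_M: "space M = X"
    using sets_eq_imp_space_eq[OF assms(2)] by (simp add: space_restrict_space)
  obtain C \<tau> where C: "C > 0" "\<tau> > 0" and decay: "\<forall>\<phi>1 \<phi>2 :: real \<Rightarrow> real. \<forall>j::nat.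
        BV_on X \<phi>1 \<longrightarrow> \<phi>2 \<in> borel_measurable M \<longrightarrow> bounded (\<phi>2 ` X) \<longrightarrow>
        \<bar>(\<integral>x. \<phi>1 x * \<phi>2 ((f ^^ j) x) \<partial>M) - (\<integral>x. \<phi>1 x \<partial>M) * (\<integral>x. \<phi>2 x \<partial>M)\<bar>
          \<le> C * exp (- \<tau> * real j) * BV_norm X \<phi>1 * Linf_norm M \<phi>2"
    using assms(4) unfolding exp_decay_BV_Linf_def space_M by (elim exE conjE) (rule that)
  interpret prob_space M by (rule prob)
  interpret decay_system M X f C \<tau>
    by unfold_locales (use assms(1,2) f_meas f_inv C decay in blast)+
  have r_pos: "r n > 0" if "n \<ge> 1" for n using assms(12) that by blast
  have mass_mono: "mono_on {1..} (\<lambda>n. real n * prob (rball X x0 (r n)))"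
    using assms(16) by (simp add: \<mu>B_eq)
  have \<psi>_le_iff: "\<psi> a \<le> \<psi> b \<longleftrightarrow> b \<le> a" if "a \<ge> 0" "b \<ge> 0" for a b
    using that monotone_onD[OF assms(7), of a b] monotone_onD[OF assms(7), of b a]
    by (cases a b rule: linorder_cases) auto
  \<comment> \<open>The maximum over \<open>i\<close> in \<open>{1..n}\<close> looks at the times
    \<open>i - 1 < n\<close>.\<close>
  have max_iff: "\<psi> \<rho> \<le> running_max \<phi> f n x \<longleftrightarrow> x \<notin> no_hit (rcball x0 \<rho>) n"
    if "n \<ge> 1" "\<rho> \<ge> 0" "x \<in> X" for n \<rho> x
  proof -
    have "\<psi> \<rho> \<le> running_max \<phi> f n x \<longleftrightarrow> (\<exists>i\<in>{1..n}. \<psi> \<rho> \<le> \<phi> ((f ^^ (i - 1)) x))"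
      unfolding running_max_def using that(1) by (subst Max_ge_iff) auto
    also have "\<dots> \<longleftrightarrow> (\<exists>i\<in>{1..n}. dist x0 ((f ^^ (i - 1)) x) \<le> \<rho>)"
      using \<psi>_le_iff[OF that(2)] by (simp add: \<phi>_eq dist_commute)
    also have "\<dots> \<longleftrightarrow> (\<exists>k<n. dist x0 ((f ^^ k) x) \<le> \<rho>)"
    proof safe
      fix i assume "i \<in> {1..n}" "dist x0 ((f ^^ (i - 1)) x) \<le> \<rho>"
      thus "\<exists>k<n. dist x0 ((f ^^ k) x) \<le> \<rho>" by (intro exI[of _ "i - 1"]) auto
    next
      fix k assume "k < n" "dist x0 ((f ^^ k) x) \<le> \<rho>"
      thus "\<exists>i\<in>{1..n}. dist x0 ((f ^^ (i - 1)) x) \<le> \<rho>" by (intro bexI[of _ "Suc k"]) auto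
    qed
    also have "\<dots> \<longleftrightarrow> x \<notin> no_hit (rcball x0 \<rho>) n"
      using that(3) funpow_in_X[OF that(3)] by (auto simp: no_hit_def rcball_def)
    finally show ?thesis .
  qed
  have H_eq: "H_ea X f x0 r = ev_hit (\<lambda>n. rball X x0 (r n)) (\<lambda>n. n)"
  proof -
    have "x \<in> H_ea X f x0 r \<longleftrightarrow> x \<in> ev_hit (\<lambda>n. rball X x0 (r n)) (\<lambda>n. n)" for x
    proof -
      have "x \<in> H_ea X f x0 r \<longleftrightarrow> (\<exists>N\<ge>1. \<forall>m\<ge>N. \<exists>k<m. x \<in> preimage_iter X f k (rball X x0 (r m)))"
        by (simp only: H_ea_def UN_iff INT_iff Bex_def Ball_def atLeast_iff lessThan_iff)
      also have "\<dots> \<longleftrightarrow> (\<exists>N\<ge>1. \<forall>m\<ge>N. x \<in> X \<and> x \<notin> no_hit (rball X x0 (r m)) m)"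
      proof -
        have "(\<exists>k<m. x \<in> preimage_iter X f k S) \<longleftrightarrow> x \<in> X \<and> x \<notin> no_hit S m" for m S
          by (auto simp: preimage_iter_def no_hit_def)
        thus ?thesis by simp
      qed
      also have "\<dots> \<longleftrightarrow> x \<in> X \<and> (\<exists>N. \<forall>m\<ge>N. x \<notin> no_hit (rball X x0 (r m)) m)"
        by (meson le_refl le_trans nat_le_linear)
      finally show ?thesis by (simp add: ev_hit_def eventually_sequentially)
    qed
    thus ?thesis by blast
  qed
  \<comment> \<open>The condition on \<open>h\<close> keeps away from \<open>r 0\<close>, whose sign
    is unknown; the index \<open>n / a\<close> rounded down is 0 for small \<open>n\<close>.\<close>
  have ev_eq: "eventually_set X (\<lambda>n x. \<psi> (r (h n)) \<le> running_max \<phi> f n x) =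
      ev_hit (\<lambda>n. rcball x0 (r (h n))) (\<lambda>n. n)" if h: "eventually (\<lambda>n. h n \<ge> 1) sequentially" for h
  proof -
    have "eventually (\<lambda>n. \<psi> (r (h n)) \<le> running_max \<phi> f n x \<longleftrightarrow> x \<notin> no_hit (rcball x0 (r (h n))) n) sequentially"
      if "x \<in> X" for x
      using h eventually_ge_at_top[of 1]
      by eventually_elim (intro max_iff that less_imp_le[OF r_pos])
    thus ?thesis unfolding eventually_set_def ev_hit_def
      by (intro Collect_cong conj_cong refl eventually_subst)
  qed
  have ev_eq': "eventually_set X (\<lambda>n x. \<psi> (r n) \<le> running_max \<phi> f n x) =
      ev_hit (\<lambda>n. rcball x0 (r n)) (\<lambda>n. n)"
    using ev_eq[of "\<lambda>n. n"] by (simp add: eventually_ge_at_top)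
  have exceed: "eventually (\<lambda>n. prob {x \<in> X. \<phi> x \<ge> u n} = prob (rcball x0 (r n))) sequentially"
    using eventually_ge_at_top[of 1]
  proof eventually_elim
    case (elim n)
    have "{x \<in> X. \<phi> x \<ge> u n} = rcball x0 (r n)"
      using \<psi>_le_iff less_imp_le[OF r_pos[OF elim]] by (auto simp: \<phi>_eq u_eq rcball_def dist_commute)
    thus ?case by simp
  qed
  have no_hit_rcball: "x \<in> no_hit (rcball x0 \<rho>) n \<Longrightarrow> x \<in> no_hit (rball X x0 \<rho>) n" for x \<rho> n
    using no_hit_mono[OF rball_subset_rcball] by blast
  \<comment> \<open>Missing the closed ball implies missing the open one, so a single statement on
    closed balls settles both sets.\<close>
  have zero: "prob (H_ea X f x0 r) = 0 \<and>
      prob (eventually_set X (\<lambda>n x. \<psi> (r n) \<le> running_max \<phi> f n x)) = 0"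
    if "AE x in M. \<exists>\<^sub>F n in sequentially. x \<in> no_hit (rcball x0 (r n)) n"
  proof
    have "AE x in M. \<exists>\<^sub>F n in sequentially. x \<in> no_hit (rball X x0 (r n)) n"
      using that by eventually_elim (auto elim: frequently_elim1 intro: no_hit_rcball)
    thus "prob (H_ea X f x0 r) = 0" unfolding H_eq by (intro prob_ev_hit_eq_0) auto
    show "prob (eventually_set X (\<lambda>n x. \<psi> (r n) \<le> running_max \<phi> f n x)) = 0"
      unfolding ev_eq' using that by (intro prob_ev_hit_eq_0) auto
  qed
  show ?thesis
  proof (intro conjI impI allI)
    fix a :: real
    assume pos: "\<forall>\<rho>>0. prob (rball X x0 \<rho>) > 0" and summ: "summable (\<lambda>n. \<mu>B n * exp (- real n * \<mu>B n))"
      and a: "a > 1"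
    define h where "h n = nat \<lfloor>real n / a\<rfloor>" for n
    have h_lim: "filterlim h at_top sequentially"
      unfolding h_def using a by real_asymp
    have "AE x in M. \<forall>\<^sub>F n in sequentially. x \<notin> no_hit (rball X x0 (r n)) (nat \<lceil>a * real n\<rceil>)"
      using AE_eventually_hit_series[OF r_pos assms(13,14) mass_mono assms(11) pos _ a] summ
      by (simp add: \<mu>B_eq)
    hence "AE x in M. \<forall>\<^sub>F n in sequentially. x \<notin> no_hit (rcball x0 (r (h n))) n"
    proof eventually_elim
      case (elim x)
      \<comment> \<open>The hitting statement is evaluated at index \<open>h n\<close>; as
        \<open>a * h n \<le> n\<close>, a hit within \<open>a * h n\<close> steps is a hit within
        \<open>n\<close>.\<close>
      have "\<forall>\<^sub>F n in sequentially. x \<notin> no_hit (rball X x0 (r (h n))) (nat \<lceil>a * real (h n)\<rceil>)"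
        using elim h_lim by (rule eventually_compose_filterlim)
      thus ?case
      proof eventually_elim
        case (elim n)
        have "real (h n) \<le> real n / a" using a by (simp add: h_def of_nat_nat)
        hence "a * real (h n) \<le> real n" using a by (simp add: field_simps)
        hence "nat \<lceil>a * real (h n)\<rceil> \<le> n" by (simp add: ceiling_le_iff nat_le_iff)
        thus ?case using elim no_hit_mono[OF rball_subset_rcball] by blast
      qed
    qed
    hence "prob (ev_hit (\<lambda>n. rcball x0 (r (h n))) (\<lambda>n. n)) = 1"
      by (intro prob_ev_hit_eq_1) auto
    moreover have "eventually (\<lambda>n. h n \<ge> 1) sequentially"
      using h_lim by (simp add: filterlim_at_top)
    ultimately show "prob (eventually_set X (\<lambda>n x. \<psi> (r (nat \<lfloor>real n / a\<rfloor>)) \<le> running_max \<phi> f n x)) = 1"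
      using ev_eq[of h] by (simp add: h_def)
  next
    assume "\<exists>c>1. \<forall>\<^sub>F n in sequentially. prob {x \<in> X. u n \<le> \<phi> x} \<ge> c * (ln (ln (real n)) / real n)"
    then obtain c where c: "c > 1" "\<forall>\<^sub>F n in sequentially. prob {x \<in> X. u n \<le> \<phi> x} \<ge> c * (ln (ln (real n)) / real n)"
      by blast
    have "\<forall>\<^sub>F n in sequentially. prob (rcball x0 (r n)) \<ge> c * (ln (ln (real n)) / real n)"
      using c(2) exceed by eventually_elim simp
    hence *: "AE x in M. \<forall>\<^sub>F n in sequentially. x \<notin> no_hit (rball X x0 (r n)) n"
      using AE_eventually_hit_loglog[OF r_pos assms(13,14) mass_mono assms(11) c(1)] by blast
    hence **: "AE x in M. \<forall>\<^sub>F n in sequentially. x \<notin> no_hit (rcball x0 (r n)) n"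
      by eventually_elim (auto elim: eventually_mono intro: no_hit_rcball)
    show "prob (H_ea X f x0 r) = 1"
      unfolding H_eq using * by (intro prob_ev_hit_eq_1) auto
    show "prob (eventually_set X (\<lambda>n x. u n \<le> running_max \<phi> f n x)) = 1"
      unfolding u_eq ev_eq' using ** by (intro prob_ev_hit_eq_1) auto
  next
    assume "\<exists>K::nat. \<forall>\<rho>\<ge>0. \<forall>x\<in>X. finite (components (preimage_iter X f 1 (rball X x \<rho>))) \<and>
          card (components (preimage_iter X f 1 (rball X x \<rho>))) \<le> K"
    then obtain K where K: "\<And>x \<rho>. x \<in> X \<Longrightarrow> \<rho> \<ge> 0 \<Longrightarrow> finite (components (preimage_iter X f 1 (rball X x \<rho>))) \<and>
          card (components (preimage_iter X f 1 (rball X x \<rho>))) \<le> K" by blast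
    {
      assume "\<exists>\<gamma>>1. \<not> summable (\<lambda>n. \<mu>B n * exp (- real n * \<gamma> * \<mu>B n))"
      then obtain \<gamma> where "\<gamma> > 1" "\<not> summable (\<lambda>n. \<mu>B n * exp (- real n * \<gamma> * \<mu>B n))" by blast
      hence "AE x in M. \<exists>\<^sub>F n in sequentially. x \<in> no_hit (rcball x0 (r n)) n"
        using AE_frequently_no_hit_series[OF r_pos assms(13,14) mass_mono K] by (simp add: \<mu>B_eq)
      note zero[OF this]
      thus "prob (H_ea X f x0 r) = 0" "prob (eventually_set X (\<lambda>n x. \<psi> (r n) \<le> running_max \<phi> f n x)) = 0"
        by blast+
    }
    {
      assume "\<exists>c<1. \<forall>\<^sub>F n in sequentially. prob {x \<in> X. u n \<le> \<phi> x} \<le> c * (ln (ln (real n)) / real n)"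
      then obtain c where c: "c < 1" "\<forall>\<^sub>F n in sequentially. prob {x \<in> X. u n \<le> \<phi> x} \<le> c * (ln (ln (real n)) / real n)"
        by blast
      have "\<forall>\<^sub>F n in sequentially. prob (rcball x0 (r n)) \<le> c * (ln (ln (real n)) / real n)"
        using c(2) exceed by eventually_elim simp
      hence "AE x in M. \<exists>\<^sub>F n in sequentially. x \<in> no_hit (rcball x0 (r n)) n"
        using AE_frequently_no_hit_loglog[OF r_pos assms(13,14) mass_mono K c(1)] by blast
      note zero[OF this]
      thus "prob (H_ea X f x0 r) = 0" "prob (eventually_set X (\<lambda>n x. u n \<le> running_max \<phi> f n x)) = 0"
        unfolding u_eq by blast+
    }
  qed
qed

end
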